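(* Let $\sigma>0$ and let $\Phi(\bm w)=\Phi(\bm x;\bm z)$ be the function defined in the context. 1) The gradient of $\Phi$ is given by $$\nabla_{\bm x_i}\Phi(\bm w)=\nabla h_i(\bm x_i)-\mathcal A_i^*\,\mathrm{prox}_{\sigma h_n^*}\Big(\sigma \bm b-\bm z_n-\sigma\sum_{j=1}^{n-1}\mathcal A_j\bm x_j\Big),\quad i\in\mathcal I_1,$$ $$\nabla_{\bm x_i}\Phi(\bm w)=\mathrm{prox}_{\sigma h_i^*}(\sigma \bm x_i-\bm z_i)-\mathcal A_i^*\,\mathrm{prox}_{\sigma h_n^*}\Big(\sigma \bm b-\bm z_n-\sigma\sum_{j=1}^{n-1}\mathcal A_j\bm x_j\Big),\quad i\in\mathcal I_2\setminus\{n\},$$ $$\nabla_{\bm z_i}\Phi(\bm w)=-\frac{1}{\sigma}\bm z_i-\frac1\sigma\,\mathrm{prox}_{\sigma h_i^*}(\sigma \bm x_i-\bm z_i),\quad i\in\mathcal I_2\setminus\{n\},$$ $$\nabla_{\bm z_n}\Phi(\bm w)=-\frac1\sigma \bm z_n-\frac1\sigma\,\mathrm{prox}_{\sigma h_n^*}\Big(\sigma \bm b-\bm z_n-\sigma\sum_{j=1}^{n-1}\mathcal A_j\bm x_j\Big).$$ 2) Suppose that problem (P) of the context has an optimal solution and that Slater's condition holds, i.e. there exist $\bm x_i\in\mathrm{ri}(\mathrm{dom}(h_i))$, $i=1,\dots,n$, with $\sum_{i=1}^{n-1}\mathcal A_i\bm x_i+\bm x_n=\bm b$. Then strong duality holds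 for $\Phi$: $$\min_{\bm x}\max_{\bm z}\Phi(\bm x;\bm z)=\max_{\bm z}\min_{\bm x}\Phi(\bm x;\bm z),$$ and both sides are equivalent to problem (P), i.e. their common value equals the optimal value of (P).
   Context: Setting. Let $0\le n_1\le n-1$ be integers, $\mathcal I_1=\{1,\dots,n_1\}$, $\mathcal I_2=\{n_1+1,\dots,n\}$. Let $\mathcal X_1,\dots,\mathcal X_n,\mathcal Y$ be finite-dimensional real Euclidean spaces with $\mathcal X_n=\mathcal Y$, let $\mathcal A_i:\mathcal X_i\to\mathcal Y$ be linear for $i=1,\dots,n-1$ (with adjoint $\mathcal A_i^*$), and let $\bm b\in\mathcal Y$. For $i\in\mathcal I_1$, $h_i:\mathcal X_i\to\mathbb R$ is convex and twice continuously differentiable with Lipschitz continuous gradient; for $i\in\mathcal I_2$, $h_i:\mathcal X_i\to(-\infty,+\infty]$ is proper, closed and convex. Problem (P) is $$\min_{\bm x_1,\dots,\bm x_n}\ \sum_{i=1}^n h_i(\bm x_i)\quad\text{s.t.}\quad \sum_{i=1}^{n-1}\mathcal A_i\bm x_i+\bm x_n=\bm b.$$ Notation. $h^*$ is the Fenchel conjugate; $\mathrm{ri}$ is the relative interior; $\mathrm{prox}_{th}(\bm x)=\arg\min_{\bm y}\{h(\bm y)+\frac1{2t}\|\bm y-\bm x\|^2\}$ for $t>0$; the Moreau envelope is $e_\sigma h(\bm x)=\min_{\bm y}\{h(\bm y)+\frac\sigma2\|\bm y-\bm x\|^2\}$. Write $\bm x=(\bm x_1,\dots,\bm x_{n-1})$,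 $\bm y=(\bm y_{n_1+1},\dots,\bm y_{n-1})$, $\bm z=(\bm z_{n_1+1},\dots,\bm z_n)$ with $\bm y_i,\bm z_i\in\mathcal X_i$, and $\bm w=(\bm x,\bm z)$. For $\sigma>0$ the augmented Lagrangian is $$\mathcal L_\sigma(\bm x,\bm x_n,\bm y;\bm z)=\sum_{i\in\mathcal I_1}h_i(\bm x_i)+\sum_{i\in\mathcal I_2\setminus\{n\}}h_i(\bm y_i)+h_n(\bm x_n)-\frac1{2\sigma}\sum_{i\in\mathcal I_2}\|\bm z_i\|^2+\frac\sigma2\Big\|\sum_{i=1}^{n-1}\mathcal A_i\bm x_i+\bm x_n-\bm b+\bm z_n/\sigma\Big\|^2+\frac\sigma2\sum_{i\in\mathcal I_2\setminus\{n\}}\|\bm x_i-\bm y_i-\bm z_i/\sigma\|^2,$$ and $\Phi(\bm x;\bm z)=\min_{\bm y,\bm x_n}\mathcal L_\sigma(\bm x,\bm x_n,\bm y;\bm z)$, that is, $$\Phi(\bm w)=\sum_{i\in\mathcal I_1}h_i(\bm x_i)+\sum_{i\in\mathcal I_2\setminus\{n\}}e_\sigma h_i\Big(\bm x_i-\frac{\bm z_i}\sigma\Big)+e_\sigma h_n\Big(\bm b-\frac{\bm z_n}\sigma-\sum_{i=1}^{n-1}\mathcal A_i\bm x_i\Big)-\frac1{2\sigma}\sum_{i\in\mathcal I_2}\|\bm z_i\|^2.$$ In part 2) "min" and "max" are read as infimum and supremum in the extended reals. *)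

theory Defs
  imports "HOL-Analysis.Analysis"
begin

text \<open>
  A finite-dimensional Euclidean space is represented as a linear subspace \<open>S\<close> of an arbitrary
  type of class \<open>euclidean_space\<close>, with the induced inner product.  Finitely many
  Euclidean spaces of different dimensions embed isometrically into one such type, so a family
  \<open>X i\<close> of subspaces covers spaces of different dimensions.  All notions below are relative
  to \<open>S\<close>: values of functions outside of \<open>S\<close> are irrelevant.
\<close>

subsection \<open>Linear maps and gradients on a subspace\<close>

definition linear_between ::
    "'v::euclidean_space set \<Rightarrow> 'w::euclidean_space set \<Rightarrow> ('v \<Rightarrow> 'w) \<Rightarrow> bool" where
  "linear_between S T f \<longleftrightarrow>
     f ` S \<subseteq> T \<and> (\<forall>x\<in>S. \<forall>y\<in>S. f (x + y) = f x + f y) \<and> (\<forall>c. \<forall>x\<in>S. f (c *\<^sub>R x) = c *\<^sub>R f x)"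

text \<open>
  The library's \<open>adjoint\<close> concerns maps on the whole type; the adjoint of a map on \<open>S\<close>
  has to take its values in \<open>S\<close>.
\<close>

definition adjoint_on ::
    "'v::euclidean_space set \<Rightarrow> ('v \<Rightarrow> 'w::euclidean_space) \<Rightarrow> 'w \<Rightarrow> 'v" where
  "adjoint_on S f y = (THE v. v \<in> S \<and> (\<forall>x\<in>S. f x \<bullet> y = x \<bullet> v))"

text \<open>
  Frechet gradient of a function that is finite on \<open>S\<close>.  The derivative within \<open>S\<close>
  determines only the component of the gradient along \<open>S\<close>, whence \<open>g \<in> S\<close>.
\<close>

definition has_gradient_on ::
    "'v::euclidean_space set \<Rightarrow> ('v \<Rightarrow> ereal) \<Rightarrow> 'v \<Rightarrow> 'v \<Rightarrow> bool" where
  "has_gradient_on S f g x \<longleftrightarrow>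
     (\<forall>u\<in>S. \<bar>f u\<bar> \<noteq> \<infinity>) \<and> g \<in> S \<and>
     ((\<lambda>u. real_of_ereal (f u)) has_derivative (\<lambda>d. g \<bullet> d)) (at x within S)"

definition gradient_on :: "'v::euclidean_space set \<Rightarrow> ('v \<Rightarrow> ereal) \<Rightarrow> 'v \<Rightarrow> 'v" where
  "gradient_on S f x = (THE g. has_gradient_on S f g x)"

definition twice_continuously_differentiable_on ::
    "'v::euclidean_space set \<Rightarrow> ('v \<Rightarrow> ereal) \<Rightarrow> bool" where
  "twice_continuously_differentiable_on S f \<longleftrightarrow>
     (\<forall>x\<in>S. has_gradient_on S f (gradient_on S f x) x) \<and>
     (\<exists>H :: 'v \<Rightarrow> 'v \<Rightarrow>\<^sub>L 'v.
        (\<forall>x\<in>S. (gradient_on S f has_derivative blinfun_apply (H x)) (at x within S)) \<and>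
        continuous_on S H)"

subsection \<open>Extended real valued convex functions on a subspace\<close>

definition effective_domain :: "'v::euclidean_space set \<Rightarrow> ('v \<Rightarrow> ereal) \<Rightarrow> 'v set" where
  "effective_domain S f = {x \<in> S. f x < \<infinity>}"

definition ereal_epigraph :: "'v::euclidean_space set \<Rightarrow> ('v \<Rightarrow> ereal) \<Rightarrow> ('v \<times> real) set" where
  "ereal_epigraph S f = {(x, r). x \<in> S \<and> f x \<le> ereal r}"

definition proper_closed_convex :: "'v::euclidean_space set \<Rightarrow> ('v \<Rightarrow> ereal) \<Rightarrow> bool" where
  "proper_closed_convex S f \<longleftrightarrow>
     (\<forall>x\<in>S. f x \<noteq> -\<infinity>) \<and> effective_domain S f \<noteq> {} \<and>
     closed (ereal_epigraph S f) \<and> convex (ereal_epigraph S f)"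

definition fenchel_conjugate :: "'v::euclidean_space set \<Rightarrow> ('v \<Rightarrow> ereal) \<Rightarrow> 'v \<Rightarrow> ereal" where
  "fenchel_conjugate S f y = (SUP x\<in>S. ereal (x \<bullet> y) - f x)"

text \<open>\<open>prox S t f\<close> is the proximal mapping of the function \<open>t f\<close>.\<close>

definition prox :: "'v::euclidean_space set \<Rightarrow> real \<Rightarrow> ('v \<Rightarrow> ereal) \<Rightarrow> 'v \<Rightarrow> 'v" where
  "prox S t f x = arg_min_on (\<lambda>y. f y + ereal (1 / (2 * t) * (norm (y - x))\<^sup>2)) S"

definition moreau_envelope ::
    "'v::euclidean_space set \<Rightarrow> real \<Rightarrow> ('v \<Rightarrow> ereal) \<Rightarrow> 'v \<Rightarrow> ereal" where
  "moreau_envelope S \<sigma> f x = (INF y\<in>S. f y + ereal (\<sigma> / 2 * (norm (y - x))\<^sup>2))"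

subsection \<open>The problem and its augmented Lagrangian\<close>

text \<open>
  The blocks are indexed by a finite type \<open>'m\<close> (so the number of blocks is \<open>CARD('m)\<close>);
  \<open>n :: 'm\<close> is the last index, \<open>I1\<close> the set of the indices of the smooth terms, with
  \<open>n \<notin> I1\<close>, and its complement \<open>- I1\<close> plays the role of the second index set.
  A tuple indexed by \<open>J\<close> is a vector of type \<open>'a ^ 'm\<close> whose remaining components
  are \<open>0\<close>; this identifies the product of the \<open>X i\<close>, \<open>i \<in> J\<close>, isometrically
  with a subspace.
\<close>

definition block_space :: "('m \<Rightarrow> 'a::euclidean_space set) \<Rightarrow> 'm set \<Rightarrow> ('a ^ 'm::finite) set" where
  "block_space X J = {v. (\<forall>i\<in>J. v $ i \<in> X i) \<and> (\<forall>i. i \<notin> J \<longrightarrow> v $ i = 0)}"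

definition P_objective ::
    "('m::finite \<Rightarrow> 'a::euclidean_space \<Rightarrow> ereal) \<Rightarrow> 'a ^ 'm \<Rightarrow> ereal" where
  "P_objective h x = (\<Sum>i\<in>UNIV. h i (x $ i))"

definition P_feasible ::
    "('m::finite \<Rightarrow> 'a::euclidean_space set) \<Rightarrow> ('m \<Rightarrow> 'a \<Rightarrow> 'a) \<Rightarrow> 'a \<Rightarrow> 'm \<Rightarrow> ('a ^ 'm) set" where
  "P_feasible X A b n = {x \<in> block_space X UNIV. (\<Sum>i\<in>-{n}. A i (x $ i)) + x $ n = b}"

definition augmented_lagrangian ::
    "('m::finite \<Rightarrow> 'a::euclidean_space \<Rightarrow> ereal) \<Rightarrow> ('m \<Rightarrow> 'a \<Rightarrow> 'a) \<Rightarrow> 'a \<Rightarrow> real \<Rightarrow> 'm set \<Rightarrow> 'm \<Rightarrow>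
     'a ^ 'm \<Rightarrow> 'a \<Rightarrow> 'a ^ 'm \<Rightarrow> 'a ^ 'm \<Rightarrow> ereal" where
  "augmented_lagrangian h A b \<sigma> I1 n x xn y z =
     (\<Sum>i\<in>I1. h i (x $ i)) + (\<Sum>i\<in>-I1 - {n}. h i (y $ i)) + h n xn
     - ereal (1 / (2 * \<sigma>) * (\<Sum>i\<in>-I1. (norm (z $ i))\<^sup>2))
     + ereal (\<sigma> / 2 * (norm ((\<Sum>i\<in>-{n}. A i (x $ i)) + xn - b + z $ n /\<^sub>R \<sigma>))\<^sup>2)
     + ereal (\<sigma> / 2 * (\<Sum>i\<in>-I1 - {n}. (norm (x $ i - y $ i - z $ i /\<^sub>R \<sigma>))\<^sup>2))"

definition Phi ::
    "('m::finite \<Rightarrow> 'a::euclidean_space set) \<Rightarrow> ('m \<Rightarrow> 'a \<Rightarrow> ereal) \<Rightarrow> ('m \<Rightarrow> 'a \<Rightarrow> 'a) \<Rightarrow> 'a \<Rightarrow>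
     real \<Rightarrow> 'm set \<Rightarrow> 'm \<Rightarrow> ('a ^ 'm) \<times> ('a ^ 'm) \<Rightarrow> ereal" where
  "Phi X h A b \<sigma> I1 n = (\<lambda>(x, z).
     INF (y, xn) \<in> block_space X (-I1 - {n}) \<times> X n. augmented_lagrangian h A b \<sigma> I1 n x xn y z)"

text \<open>The closed form of \<open>Phi\<close> in terms of Moreau envelopes.\<close>

lemma INF_add_independent:
  fixes f :: "'p \<Rightarrow> ereal" and g :: "'q \<Rightarrow> ereal"
  assumes "A \<noteq> {}" "B \<noteq> {}"
    and f: "\<And>x. x \<in> A \<Longrightarrow> f x \<noteq> -\<infinity>" and g: "\<And>y. y \<in> B \<Longrightarrow> g y \<noteq> -\<infinity>"
  shows "(INF (x, y)\<in>A \<times> B. f x + g y) = (INF x\<in>A. f x) + (INF y\<in>B. g y)"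
proof (rule antisym)
  show "(INF x\<in>A. f x) + (INF y\<in>B. g y) \<le> (INF (x, y)\<in>A \<times> B. f x + g y)"
    by (rule INF_greatest) (auto intro!: add_mono INF_lower)
next
  let ?L = "INF (x, y)\<in>A \<times> B. f x + g y"
  have *: "?L \<le> f x + g y" if "x \<in> A" "y \<in> B" for x y
    using INF_lower[of "(x, y)" "A \<times> B" "\<lambda>(x, y). f x + g y"] that by simp
  have L1: "?L \<le> f x + (INF y\<in>B. g y)" if x: "x \<in> A" for x
  proof (cases "f x")
    case (real r)
    have "?L - ereal r \<le> (INF y\<in>B. g y)"
      using *[OF x] real by (intro INF_greatest) (simp add: ereal_minus_le_iff add.commute)
    then show ?thesis using real by (simp add: ereal_minus_le_iff add.commute)
  qed (use f[OF x] in auto)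
  show "?L \<le> (INF x\<in>A. f x) + (INF y\<in>B. g y)"
  proof (cases "INF y\<in>B. g y")
    case (real r)
    have "?L - ereal r \<le> (INF x\<in>A. f x)"
      using L1 real by (intro INF_greatest) (simp add: ereal_minus_le_iff add.commute)
    then show ?thesis using real by (simp add: ereal_minus_le_iff add.commute)
  next
    case MInf
    show ?thesis
    proof (cases "\<exists>x\<in>A. f x \<noteq> \<infinity>")
      case True
      then obtain x where x: "x \<in> A" "f x \<noteq> \<infinity>" by blast
      then have "f x + (INF y\<in>B. g y) = -\<infinity>" using MInf f[of x] by (cases "f x") auto
      with L1[OF x(1)] show ?thesis by simp
    next
      case False
      then have "(INF x\<in>A. f x) = \<infinity>" using \<open>A \<noteq> {}\<close> by simp
      then show ?thesis by simp
    qed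
  qed auto
qed

lemma sum_ereal_not_MInf:
  fixes f :: "'i \<Rightarrow> ereal"
  shows "(\<And>i. i \<in> J \<Longrightarrow> f i \<noteq> -\<infinity>) \<Longrightarrow> sum f J \<noteq> -\<infinity>"
  by (induction J rule: infinite_finite_induct) auto

lemma INF_block_space_sum:
  fixes \<phi> :: "'m::finite \<Rightarrow> 'a::euclidean_space \<Rightarrow> ereal"
  assumes ne: "\<And>i. X i \<noteq> {}" and \<phi>: "\<And>i v. i \<in> J \<Longrightarrow> v \<in> X i \<Longrightarrow> \<phi> i v \<noteq> -\<infinity>"
  shows "block_space X J \<noteq> {} \<and>
    (INF y\<in>block_space X J. \<Sum>i\<in>J. \<phi> i (y $ i)) = (\<Sum>i\<in>J. INF v\<in>X i. \<phi> i v)"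
proof -
  have "finite J" by simp
  then show ?thesis using \<phi>
  proof (induction J)
    case empty
    have "block_space X {} = {0}" by (auto simp: block_space_def vec_eq_iff)
    then show ?case by simp
  next
    case (insert j J)
    let ?B = "block_space X J" and ?B' = "block_space X (insert j J)"
    let ?up = "\<lambda>(v, y). \<chi> i. if i = j then v else y $ i"
    have B': "?B' = ?up ` (X j \<times> ?B)"
    proof (intro set_eqI iffI)
      fix y assume y: "y \<in> ?B'"
      then have "(\<chi> i. if i = j then 0 else y $ i) \<in> ?B" "y $ j \<in> X j"
        using insert.hyps by (auto simp: block_space_def)
      moreover have "y = ?up (y $ j, \<chi> i. if i = j then 0 else y $ i)"
        by (simp add: vec_eq_iff)
      ultimately show "y \<in> ?up ` (X j \<times> ?B)" by blast
    next
      fix y assume "y \<in> ?up ` (X j \<times> ?B)"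
      then show "y \<in> ?B'" by (auto simp: block_space_def)
    qed
    have IH: "?B \<noteq> {}" "(INF y\<in>?B. \<Sum>i\<in>J. \<phi> i (y $ i)) = (\<Sum>i\<in>J. INF v\<in>X i. \<phi> i v)"
      using insert.IH insert.prems by auto
    have "(INF y\<in>?B'. \<Sum>i\<in>insert j J. \<phi> i (y $ i)) =
        (INF (v, y)\<in>X j \<times> ?B. \<Sum>i\<in>insert j J. \<phi> i (?up (v, y) $ i))"
      unfolding B' image_image by (intro INF_cong refl) auto
    also have "\<dots> = (INF (v, y)\<in>X j \<times> ?B. \<phi> j v + (\<Sum>i\<in>J. \<phi> i (y $ i)))"
    proof (intro INF_cong refl)
      fix p assume "p \<in> X j \<times> ?B"
      obtain v y where p: "p = (v, y)" by (cases p)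
      have "(\<Sum>i\<in>J. \<phi> i (?up (v, y) $ i)) = (\<Sum>i\<in>J. \<phi> i (y $ i))"
        using insert.hyps by (intro sum.cong) auto
      then show "(case p of (v, y) \<Rightarrow> \<Sum>i\<in>insert j J. \<phi> i (?up (v, y) $ i)) =
          (case p of (v, y) \<Rightarrow> \<phi> j v + (\<Sum>i\<in>J. \<phi> i (y $ i)))"
        using insert.hyps p by simp
    qed
    also have "\<dots> = (INF v\<in>X j. \<phi> j v) + (INF y\<in>?B. \<Sum>i\<in>J. \<phi> i (y $ i))"
    proof (rule INF_add_independent)
      show "(\<Sum>i\<in>J. \<phi> i (y $ i)) \<noteq> -\<infinity>" if "y \<in> ?B" for y
        using that insert.prems by (intro sum_ereal_not_MInf) (auto simp: block_space_def)
    qed (use ne IH insert.prems in auto)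
    finally show ?case using insert.hyps IH B' ne[of j] by auto
  qed
qed

lemma Phi_eq_moreau_envelopes:
  fixes X :: "'m::finite \<Rightarrow> 'a::euclidean_space set"
  assumes ne: "\<And>i. X i \<noteq> {}" and h: "\<And>i v. v \<in> X i \<Longrightarrow> h i v \<noteq> -\<infinity>"
    and n: "n \<notin> I1" and fin: "\<And>i. i \<in> I1 \<Longrightarrow> \<bar>h i (x $ i)\<bar> \<noteq> \<infinity>"
  shows "Phi X h A b \<sigma> I1 n (x, z) =
     (\<Sum>i\<in>I1. h i (x $ i))
     + (\<Sum>i\<in>-I1 - {n}. moreau_envelope (X i) \<sigma> (h i) (x $ i - z $ i /\<^sub>R \<sigma>))
     + moreau_envelope (X n) \<sigma> (h n) (b - z $ n /\<^sub>R \<sigma> - (\<Sum>i\<in>-{n}. A i (x $ i)))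
     - ereal (1 / (2 * \<sigma>) * (\<Sum>i\<in>-I1. (norm (z $ i))\<^sup>2))"
proof -
  let ?J = "-I1 - {n}" and ?c = "\<Sum>i\<in>I1. h i (x $ i)"
  let ?q = "1 / (2 * \<sigma>) * (\<Sum>i\<in>-I1. (norm (z $ i))\<^sup>2)"
  let ?u = "b - z $ n /\<^sub>R \<sigma> - (\<Sum>i\<in>-{n}. A i (x $ i))"
  define \<phi> where "\<phi> i v = h i v + ereal (\<sigma> / 2 * (norm (v - (x $ i - z $ i /\<^sub>R \<sigma>)))\<^sup>2)" for i v
  define \<psi> where "\<psi> v = h n v + ereal (\<sigma> / 2 * (norm (v - ?u))\<^sup>2)" for v
  have \<phi>: "\<phi> i v \<noteq> -\<infinity>" if "v \<in> X i" for i v using h[OF that] by (simp add: \<phi>_def)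
  have \<psi>: "\<psi> v \<noteq> -\<infinity>" if "v \<in> X n" for v using h[OF that] by (simp add: \<psi>_def)
  have "\<bar>?c\<bar> \<noteq> \<infinity>" using fin by (simp add: sum_Inf)
  then obtain c where c: "?c = ereal c" by auto
  have blocks: "block_space X ?J \<noteq> {} \<and>
      (INF y\<in>block_space X ?J. \<Sum>i\<in>?J. \<phi> i (y $ i)) = (\<Sum>i\<in>?J. INF v\<in>X i. \<phi> i v)"
    by (intro INF_block_space_sum ne \<phi>)
  let ?F = "INF (y, xn)\<in>block_space X ?J \<times> X n. (\<Sum>i\<in>?J. \<phi> i (y $ i)) + \<psi> xn"
  have cq: "ereal (c - ?q) = ereal c + - ereal ?q" by simp
  have L: "augmented_lagrangian h A b \<sigma> I1 n x xn y z =
      ereal (c - ?q) + ((\<Sum>i\<in>?J. \<phi> i (y $ i)) + \<psi> xn)" for xn y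
  proof -
    have 1: "norm ((\<Sum>i\<in>-{n}. A i (x $ i)) + xn - b + z $ n /\<^sub>R \<sigma>) = norm (xn - ?u)"
      by (simp add: algebra_simps)
    have 2: "norm (x $ i - y $ i - z $ i /\<^sub>R \<sigma>) = norm (y $ i - (x $ i - z $ i /\<^sub>R \<sigma>))" for i
      by (subst norm_minus_commute) (simp add: algebra_simps)
    have 3: "(\<Sum>i\<in>?J. \<phi> i (y $ i)) = (\<Sum>i\<in>?J. h i (y $ i)) +
        ereal (\<sigma> / 2 * (\<Sum>i\<in>?J. (norm (x $ i - y $ i - z $ i /\<^sub>R \<sigma>))\<^sup>2))"
      unfolding \<phi>_def 2 by (simp add: sum.distrib sum_distrib_left)
    show ?thesis
      unfolding augmented_lagrangian_def 3 \<psi>_def 1 c cq minus_ereal_def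
      by (simp only: add_ac)
  qed
  have "Phi X h A b \<sigma> I1 n (x, z) = (INF (y, xn)\<in>block_space X ?J \<times> X n.
      ereal (c - ?q) + ((\<Sum>i\<in>?J. \<phi> i (y $ i)) + \<psi> xn))"
    unfolding Phi_def prod.case L ..
  also have "\<dots> = (INF u\<in>{()}. ereal (c - ?q)) + ?F"
  proof -
    have "(INF (u, p)\<in>{()} \<times> (block_space X ?J \<times> X n).
        ereal (c - ?q) + (case p of (y, xn) \<Rightarrow> (\<Sum>i\<in>?J. \<phi> i (y $ i)) + \<psi> xn)) =
        (INF u\<in>{()}. ereal (c - ?q)) + ?F"
    proof (rule INF_add_independent)
      show "(case p of (y, xn) \<Rightarrow> (\<Sum>i\<in>?J. \<phi> i (y $ i)) + \<psi> xn) \<noteq> -\<infinity>"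
        if "p \<in> block_space X ?J \<times> X n" for p
      proof -
        obtain y xn where p: "p = (y, xn)" by (cases p)
        have "(\<Sum>i\<in>?J. \<phi> i (y $ i)) \<noteq> -\<infinity>"
          using that p by (intro sum_ereal_not_MInf \<phi>) (auto simp: block_space_def)
        then show ?thesis using that p \<psi>[of xn] by auto
      qed
    qed (use blocks ne in auto)
    moreover have "{()} \<times> (block_space X ?J \<times> X n) = Pair () ` (block_space X ?J \<times> X n)" by auto
    ultimately show ?thesis by (simp add: image_comp comp_def case_prod_unfold)
  qed
  also have "?F = (INF y\<in>block_space X ?J. \<Sum>i\<in>?J. \<phi> i (y $ i)) + (INF v\<in>X n. \<psi> v)"
  proof (rule INF_add_independent)
    show "(\<Sum>i\<in>?J. \<phi> i (y $ i)) \<noteq> -\<infinity>" if "y \<in> block_space X ?J" for y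
      using that by (intro sum_ereal_not_MInf \<phi>) (auto simp: block_space_def)
  qed (use blocks ne \<psi> in auto)
  finally show ?thesis
    unfolding c cq blocks[THEN conjunct2]
    by (simp add: moreau_envelope_def \<phi>_def \<psi>_def minus_ereal_def add_ac
        flip: plus_ereal.simps(1))
qed

end

theory Submission
  imports Defs
begin

text \<open>
  The minimizer \<open>p\<close> defining the Moreau envelope at \<open>v\<close> satisfies
  \<open>\<sigma> (v - p) \<in> \<partial>h(p)\<close>.  Comparing the minimizers at \<open>u\<close> and \<open>v\<close> gives
  \<open>0 \<le> e(u) - e(v) - w \<bullet> (u - v) \<le> \<sigma>/2 \<parallel>u - v\<parallel>\<^sup>2\<close> with \<open>w = \<sigma> (v - p)\<close>, so \<open>w\<close> is the
  gradient of the envelope; by Fenchel duality \<open>w\<close> is also the proximal point of \<open>\<sigma> h\<^sup>*\<close> at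
  \<open>\<sigma> v\<close>.  The gradient of \<open>Phi\<close> follows by the chain rule.

  For the duality, the choice \<open>y = x\<close>, \<open>x\<^sub>n = b - \<Sum> A\<^sub>i x\<^sub>i\<close> turns the augmented Lagrangian into the
  objective of (P), whatever \<open>z\<close> is, so that \<open>sup inf \<le> inf sup \<le> val(P)\<close>.  Conversely, Slater's
  condition yields a Lagrange multiplier \<open>l\<close> of the coupling constraint, and with \<open>z\<^sub>n = l\<close>,
  \<open>z\<^sub>i = A\<^sub>i\<^sup>* l\<close> the augmented Lagrangian is bounded below by \<open>val(P)\<close>.
\<close>

subsection \<open>Moreau envelopes\<close>

text \<open>
  The inequality says that \<open>\<sigma> (v - p)\<close> is a subgradient of \<open>f\<close> at \<open>p\<close>, which characterizes the
  minimizer \<open>p\<close> of \<open>f + \<sigma>/2 \<parallel>\<cdot> - v\<parallel>\<^sup>2\<close>.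
\<close>

definition proximal_point ::
    "'v::euclidean_space set \<Rightarrow> real \<Rightarrow> ('v \<Rightarrow> ereal) \<Rightarrow> 'v \<Rightarrow> 'v \<Rightarrow> bool" where
  "proximal_point S \<sigma> f v p \<longleftrightarrow>
     p \<in> S \<and> \<bar>f p\<bar> \<noteq> \<infinity> \<and> (\<forall>y\<in>S. f p + ereal (\<sigma> * ((v - p) \<bullet> (y - p))) \<le> f y)"

section \<open>Existence of proximal points\<close>

lemma power2_norm_diff:
  fixes a b :: "'v::real_inner"
  shows "(norm (a - b))\<^sup>2 = (norm a)\<^sup>2 - 2 * (a \<bullet> b) + (norm b)\<^sup>2"
  unfolding power2_norm_eq_inner by (simp add: inner_diff_left inner_diff_right inner_commute)

text \<open>A point just below the graph is strictly separated from the closed convex epigraph. The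
  point of the graph above it lies on the other side, so the hyperplane is not vertical and is the
  graph of an affine function below \<open>f\<close>.\<close>

lemma affine_minorant_exists:
  assumes "proper_closed_convex S f"
  shows "\<exists>c a. \<forall>y r. (y, r) \<in> ereal_epigraph S f \<longrightarrow> c - a \<bullet> y \<le> r"
proof -
  from assms obtain x0 where x0: "x0 \<in> S" "f x0 < \<infinity>" "f x0 \<noteq> -\<infinity>"
    by (auto simp: proper_closed_convex_def effective_domain_def)
  then obtain r0 where r0: "f x0 = ereal r0" by (cases "f x0") auto
  have "(x0, r0 - 1) \<notin> ereal_epigraph S f" using r0 by (simp add: ereal_epigraph_def)
  moreover have "convex (ereal_epigraph S f)" "closed (ereal_epigraph S f)"
    using assms by (auto simp: proper_closed_convex_def)
  ultimately obtain A B where AB: "A \<bullet> (x0, r0 - 1) < B" "\<forall>x\<in>ereal_epigraph S f. A \<bullet> x > B"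
    using separating_hyperplane_closed_point by blast
  obtain a1 a2 where A: "A = (a1, a2)" by fastforce
  have "(x0, r0) \<in> ereal_epigraph S f" using x0 r0 by (simp add: ereal_epigraph_def)
  with AB A have "a1 \<bullet> x0 + a2 * (r0 - 1) < a1 \<bullet> x0 + a2 * r0" by force
  then have a2: "a2 > 0" by (simp add: algebra_simps)
  show ?thesis
  proof (rule exI[of _ "B / a2"], rule exI[of _ "a1 /\<^sub>R a2"], intro allI impI)
    fix y r assume "(y, r) \<in> ereal_epigraph S f"
    with AB A have "B < a1 \<bullet> y + a2 * r" by force
    then show "B / a2 - (a1 /\<^sub>R a2) \<bullet> y \<le> r" using a2 by (simp add: field_simps)
  qed
qed

text \<open>The objective is lifted to the continuous function \<open>q\<close> on the epigraph, so
  that closedness of the epigraph takes the place of lower semicontinuity of \<open>f\<close>. The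
  quadratic beats the affine minorant, hence sublevel sets are compact and a minimizer exists.
  Comparing it with points of segments through the convex epigraph yields the subgradient
  inequality.\<close>

lemma proximal_point_exists:
  assumes f: "proper_closed_convex S f" and \<sigma>: "\<sigma> > 0"
  obtains p where "proximal_point S \<sigma> f v p"
proof -
  let ?E = "ereal_epigraph S f"
  define q where "q = (\<lambda>(y, r). r + \<sigma> / 2 * (norm (y - v))\<^sup>2 :: real)"
  have E: "closed ?E" "convex ?E" and nMInf: "\<And>x. x \<in> S \<Longrightarrow> f x \<noteq> -\<infinity>"
    using f by (auto simp: proper_closed_convex_def)
  obtain c a where ac: "\<And>y r. (y, r) \<in> ?E \<Longrightarrow> c - a \<bullet> y \<le> r"
    using affine_minorant_exists[OF f] by fast
  from f obtain x0 where x0: "x0 \<in> S" "f x0 < \<infinity>"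
    by (auto simp: proper_closed_convex_def effective_domain_def)
  then obtain r0 where r0: "f x0 = ereal r0" using nMInf[of x0] by (cases "f x0") auto
  have x0E: "(x0, r0) \<in> ?E" using x0 r0 by (simp add: ereal_epigraph_def)
  define M where "M = q (x0, r0)"
  define M' where "M' = M - c + a \<bullet> v"
  \<comment> \<open>A radius for the sublevel set: for \<open>t > T\<close> the inequality
    \<open>\<sigma> / 2 * t\<^sup>2 \<le> M' + norm a * t\<close> derived below fails. The summand 1
    ensures \<open>t \<ge> 1\<close>, which is needed to absorb \<open>\<bar>M'\<bar>\<close> into
    \<open>\<bar>M'\<bar> * t\<close>.\<close>
  define T where "T = 2 * (norm a + \<bar>M'\<bar>) / \<sigma> + 1"
  define K where "K = ?E \<inter> {x. q x \<le> M}"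
  have q_cont: "continuous_on UNIV q"
    unfolding q_def case_prod_unfold by (intro continuous_intros)
  have "closed K" unfolding K_def using E q_cont
    by (intro closed_Int closed_Collect_le continuous_on_const) auto
  moreover have "K \<subseteq> cball v T \<times> {c - a \<bullet> v - norm a * T..M}"
  proof
    fix x assume "x \<in> K"
    moreover obtain y r where x: "x = (y, r)" by fastforce
    ultimately have yr: "(y, r) \<in> ?E" "r + \<sigma> / 2 * (norm (y - v))\<^sup>2 \<le> M"
      by (auto simp: K_def q_def)
    define t where "t = norm (y - v)"
    have t0: "t \<ge> 0" by (simp add: t_def)
    have ay: "a \<bullet> y \<le> a \<bullet> v + norm a * t"
      using norm_cauchy_schwarz[of a "y - v"] by (simp add: t_def inner_diff_right)
    have t: "\<sigma> / 2 * t\<^sup>2 \<le> M' + norm a * t"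
      using ac[OF yr(1)] yr(2) ay unfolding M'_def t_def by linarith
    have "t \<le> T"
    proof (rule ccontr)
      assume "\<not> t \<le> T"
      then have tT: "t > T" by simp
      have T1: "T \<ge> 1" using \<sigma> by (simp add: T_def)
      have "2 * (norm a + \<bar>M'\<bar>) / \<sigma> < t" using tT by (simp add: T_def)
      then have "norm a + \<bar>M'\<bar> < \<sigma> / 2 * t" using \<sigma> by (simp add: field_simps)
      then have "(norm a + \<bar>M'\<bar>) * t < (\<sigma> / 2 * t) * t"
        using tT T1 by (intro mult_strict_right_mono) auto
      moreover have "\<bar>M'\<bar> * 1 \<le> \<bar>M'\<bar> * t" using tT T1 by (intro mult_left_mono) auto
      ultimately show False using t by (simp add: algebra_simps power2_eq_square)
    qed
    moreover have "norm a * t \<le> norm a * T" using \<open>t \<le> T\<close> by (simp add: mult_left_mono)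
    moreover have "r \<le> M" using yr(2) \<sigma>
      by (smt (verit) divide_nonneg_pos mult_nonneg_nonneg zero_le_power2)
    ultimately show "x \<in> cball v T \<times> {c - a \<bullet> v - norm a * T..M}"
      using ac[OF yr(1)] ay by (simp add: x t_def dist_norm norm_minus_commute)
  qed
  ultimately have "compact K"
    using bounded_subset[OF bounded_Times[OF bounded_cball bounded_closed_interval]]
    by (auto simp: compact_eq_bounded_closed)
  moreover have "(x0, r0) \<in> K" using x0E by (simp add: K_def M_def)
  ultimately obtain m where m: "m \<in> K" "\<forall>x\<in>K. q m \<le> q x"
    using continuous_attains_inf[of K q] continuous_on_subset[OF q_cont] by blast
  \<comment> \<open>Outside \<open>K\<close> the value of \<open>q\<close> exceeds \<open>M\<close>,
    and \<open>q m \<le> M\<close>, so the minimum over \<open>K\<close> is global.\<close>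
  have min: "q m \<le> q x" if "x \<in> ?E" for x
    using m that by (cases "q x \<le> M") (auto simp: K_def)
  obtain p rp where mp: "m = (p, rp)" by fastforce
  have pS: "p \<in> S" "f p \<le> ereal rp" using m mp by (auto simp: K_def ereal_epigraph_def)
  then obtain fp where fp: "f p = ereal fp" using nMInf[of p] by (cases "f p") auto
  have pE: "(p, fp) \<in> ?E" using pS fp by (simp add: ereal_epigraph_def)
  have min': "fp + \<sigma> / 2 * (norm (p - v))\<^sup>2 \<le> r + \<sigma> / 2 * (norm (y - v))\<^sup>2" if "(y, r) \<in> ?E" for y r
    using min[OF that] pS fp mp by (auto simp: q_def)
  have sub: "fp + \<sigma> * ((v - p) \<bullet> (y - p)) \<le> r" if yr: "(y, r) \<in> ?E" for y r
  proof (rule ccontr)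
    assume neg: "\<not> ?thesis"
    define k where "k = fp + \<sigma> * ((v - p) \<bullet> (y - p)) - r"
    define Q where "Q = \<sigma> / 2 * (norm (y - p))\<^sup>2"
    \<comment> \<open>Moving the fraction \<open>t\<close> from \<open>p\<close> towards
      \<open>y\<close> gains \<open>t * k\<close> to first order and costs
      \<open>t * (t * Q)\<close>. This \<open>t\<close> makes the gain larger than the cost;
      \<open>Q + 1\<close> keeps the quotient meaningful for \<open>Q = 0\<close>.\<close>
    define t where "t = min 1 (k / (Q + 1))"
    have k: "k > 0" using neg by (simp add: k_def)
    have Q: "Q \<ge> 0" using \<sigma> by (simp add: Q_def)
    have t: "0 < t" "t \<le> 1" "t \<le> k / (Q + 1)" using k Q by (auto simp: t_def)
    have "(1 - t) *\<^sub>R (p, fp) + t *\<^sub>R (y, r) \<in> ?E"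
      using t by (intro convexD[OF E(2) pE yr]) auto
    then have "((1 - t) *\<^sub>R p + t *\<^sub>R y, (1 - t) * fp + t * r) \<in> ?E" by simp
    from min'[OF this]
    have "fp + \<sigma> / 2 * (norm (p - v))\<^sup>2 \<le>
        (1 - t) * fp + t * r + \<sigma> / 2 * (norm ((1 - t) *\<^sub>R p + t *\<^sub>R y - v))\<^sup>2" .
    also have "(1 - t) *\<^sub>R p + t *\<^sub>R y - v = t *\<^sub>R (y - p) - (v - p)" by (simp add: algebra_simps)
    also have "\<sigma> / 2 * (norm (t *\<^sub>R (y - p) - (v - p)))\<^sup>2 =
        t * (t * Q) - t * (\<sigma> * ((v - p) \<bullet> (y - p))) + \<sigma> / 2 * (norm (p - v))\<^sup>2"
      unfolding power2_norm_diff[of "t *\<^sub>R (y - p)"] Q_def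
      by (simp add: distrib_left right_diff_distrib power_mult_distrib power2_eq_square
          inner_commute norm_minus_commute)
    finally have "t * k \<le> t * (t * Q)"
      unfolding k_def by (simp add: distrib_left right_diff_distrib left_diff_distrib)
    then have "k \<le> t * Q" using t by simp
    also have "\<dots> \<le> k / (Q + 1) * Q" using t Q by (intro mult_right_mono) auto
    also have "\<dots> < k" using k Q by (simp add: field_simps)
    finally show False by simp
  qed
  have "f p + ereal (\<sigma> * ((v - p) \<bullet> (y - p))) \<le> f y" if "y \<in> S" for y
  proof (cases "f y")
    case (real r)
    with that have "(y, r) \<in> ?E" by (simp add: ereal_epigraph_def)
    from sub[OF this] show ?thesis by (simp add: real fp)
  qed (use nMInf[OF that] in auto)
  then show ?thesis using pS fp that[of p] by (simp add: proximal_point_def)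
qed

text \<open>Expanding the square at \<open>y\<close> around \<open>p\<close> produces a cross term
  that the subgradient inequality at \<open>p\<close> cancels; the square of \<open>y - p\<close> is
  left over as a surplus.\<close>

lemma proximal_point_strong_minimum:
  assumes p: "proximal_point S \<sigma> f v p" and y: "y \<in> S"
  shows "f p + ereal (\<sigma> / 2 * (norm (p - v))\<^sup>2 + \<sigma> / 2 * (norm (y - p))\<^sup>2)
    \<le> f y + ereal (\<sigma> / 2 * (norm (y - v))\<^sup>2)"
proof -
  have "norm (y - v) ^ 2 = norm ((y - p) - (v - p)) ^ 2" by simp
  also have "\<dots> = (norm (y - p))\<^sup>2 - 2 * ((v - p) \<bullet> (y - p)) + (norm (p - v))\<^sup>2"
    unfolding power2_norm_diff[of "y - p"] by (simp only: inner_commute norm_minus_commute)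
  finally have *: "\<sigma> / 2 * (norm (y - v))\<^sup>2 =
      \<sigma> / 2 * (norm (p - v))\<^sup>2 + \<sigma> / 2 * (norm (y - p))\<^sup>2 - \<sigma> * ((v - p) \<bullet> (y - p))"
    by (simp add: distrib_left right_diff_distrib)
  have "f p + ereal (\<sigma> * ((v - p) \<bullet> (y - p))) \<le> f y" "\<bar>f p\<bar> \<noteq> \<infinity>"
    using assms by (auto simp: proximal_point_def)
  then show ?thesis unfolding * by (cases "f p"; cases "f y") auto
qed

lemma moreau_envelope_proximal_point:
  assumes p: "proximal_point S \<sigma> f v p" and \<sigma>: "\<sigma> > 0"
  shows "moreau_envelope S \<sigma> f v = f p + ereal (\<sigma> / 2 * (norm (p - v))\<^sup>2)"
  unfolding moreau_envelope_def
proof (rule antisym)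
  show "(INF y\<in>S. f y + ereal (\<sigma> / 2 * (norm (y - v))\<^sup>2)) \<le> f p + ereal (\<sigma> / 2 * (norm (p - v))\<^sup>2)"
    using p by (intro INF_lower) (simp add: proximal_point_def)
  show "f p + ereal (\<sigma> / 2 * (norm (p - v))\<^sup>2) \<le> (INF y\<in>S. f y + ereal (\<sigma> / 2 * (norm (y - v))\<^sup>2))"
  proof (rule INF_greatest)
    fix y assume y: "y \<in> S"
    have "f p + ereal (\<sigma> / 2 * (norm (p - v))\<^sup>2) \<le>
        f p + ereal (\<sigma> / 2 * (norm (p - v))\<^sup>2 + \<sigma> / 2 * (norm (y - p))\<^sup>2)"
      using \<sigma> by (intro add_left_mono) simp
    also note proximal_point_strong_minimum[OF p y]
    finally show "f p + ereal (\<sigma> / 2 * (norm (p - v))\<^sup>2) \<le> f y + ereal (\<sigma> / 2 * (norm (y - v))\<^sup>2)" .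
  qed
qed

text \<open>This is Moreau's decomposition. Since \<open>\<sigma> *\<^sub>R (v - p)\<close> is a
  subgradient of \<open>f\<close> at \<open>p\<close>, the Fenchel-Young inequality is an equality
  there, and \<open>p\<close> is in turn a subgradient of the conjugate at that point. This is the
  optimality condition for the proximal problem of the conjugate.\<close>

lemma prox_fenchel_conjugate:
  assumes S: "subspace S" and v: "v \<in> S" and p: "proximal_point S \<sigma> f v p" and \<sigma>: "\<sigma> > 0"
  shows "prox S \<sigma> (fenchel_conjugate S f) (\<sigma> *\<^sub>R v) = \<sigma> *\<^sub>R (v - p)"
proof -
  define w where "w = \<sigma> *\<^sub>R (v - p)"
  have pS: "p \<in> S" using p by (simp add: proximal_point_def)
  obtain fp where fp: "f p = ereal fp" using p by (auto simp: proximal_point_def)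
  have wS: "w \<in> S" unfolding w_def using S v pS by (intro subspace_scale subspace_diff)
  let ?g = "fenchel_conjugate S f"
  have low: "ereal (p \<bullet> y - fp) \<le> ?g y" for y
    unfolding fenchel_conjugate_def using pS fp by (intro SUP_upper2[of p]) auto
  have gw: "?g w = ereal (p \<bullet> w - fp)"
  proof (rule antisym[OF _ low])
    show "?g w \<le> ereal (p \<bullet> w - fp)"
      unfolding fenchel_conjugate_def
    proof (rule SUP_least)
      fix x assume "x \<in> S"
      with p fp have "ereal (fp + \<sigma> * ((v - p) \<bullet> (x - p))) \<le> f x"
        by (auto simp: proximal_point_def)
      moreover have "\<sigma> * ((v - p) \<bullet> (x - p)) = x \<bullet> w - p \<bullet> w"
        by (simp add: w_def inner_diff_left inner_diff_right inner_commute algebra_simps)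
      ultimately show "ereal (x \<bullet> w) - f x \<le> ereal (p \<bullet> w - fp)"
        by (cases "f x") auto
    qed
  qed
  let ?F = "\<lambda>y. ?g y + ereal (1 / (2 * \<sigma>) * (norm (y - \<sigma> *\<^sub>R v))\<^sup>2)"
  have strong: "?F w + ereal (1 / (2 * \<sigma>) * (norm (y - w))\<^sup>2) \<le> ?F y" for y
  proof -
    \<comment> \<open>Since \<open>w - \<sigma> *\<^sub>R v = - (\<sigma> *\<^sub>R p)\<close>,
      expanding the square around \<open>w\<close> gives the linear term
      \<open>- (p \<bullet> (y - w))\<close>, which the lower bound \<open>low\<close> on the
      conjugate compensates.\<close>
    have "norm (y - \<sigma> *\<^sub>R v) = norm ((y - w) - \<sigma> *\<^sub>R p)" by (simp add: w_def algebra_simps)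
    moreover have "norm ((y - w) - \<sigma> *\<^sub>R p) ^ 2 =
        norm (y - w) ^ 2 - 2 * \<sigma> * (p \<bullet> (y - w)) + \<sigma>\<^sup>2 * norm p ^ 2"
      unfolding power2_norm_diff by (simp add: inner_commute power_mult_distrib)
    moreover have "norm (w - \<sigma> *\<^sub>R v) = norm (\<sigma> *\<^sub>R p)" by (simp add: w_def algebra_simps)
    ultimately have "(norm (y - \<sigma> *\<^sub>R v))\<^sup>2 =
        (norm (w - \<sigma> *\<^sub>R v))\<^sup>2 + (norm (y - w))\<^sup>2 - 2 * \<sigma> * (p \<bullet> (y - w))"
      by (simp add: power_mult_distrib)
    then have *: "1 / (2 * \<sigma>) * (norm (y - \<sigma> *\<^sub>R v))\<^sup>2 =
        1 / (2 * \<sigma>) * (norm (w - \<sigma> *\<^sub>R v))\<^sup>2 + 1 / (2 * \<sigma>) * (norm (y - w))\<^sup>2 - p \<bullet> (y - w)"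
      using \<sigma> by (simp add: add_divide_distrib diff_divide_distrib)
    show ?thesis unfolding * gw using low[of y]
      by (cases "?g y") (auto simp: inner_diff_right)
  qed
  have "is_arg_min ?F (\<lambda>y. y \<in> S) w"
    unfolding is_arg_min_linorder
  proof (intro conjI allI impI wS)
    fix y
    have "?F w + 0 \<le> ?F w + ereal (1 / (2 * \<sigma>) * (norm (y - w))\<^sup>2)"
      using \<sigma> by (intro add_left_mono) simp
    also note strong[of y]
    finally show "?F w \<le> ?F y" by simp
  qed
  \<comment> \<open>The value \<open>prox\<close> is an arbitrarily chosen minimizer, so minimality
    of \<open>w\<close> does not suffice; the surplus term in \<open>strong\<close> makes it the
    only one.\<close>
  moreover have "y = w" if y: "is_arg_min ?F (\<lambda>y. y \<in> S) y" for y
  proof -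
    have "?F y \<le> ?F w" using y wS unfolding is_arg_min_linorder by blast
    with strong[of y] have "?F w + ereal (1 / (2 * \<sigma>) * (norm (y - w))\<^sup>2) \<le> ?F w" by order
    then have "1 / (2 * \<sigma>) * (norm (y - w))\<^sup>2 \<le> 0" unfolding gw by simp
    then show ?thesis using \<sigma> by (simp add: field_simps)
  qed
  ultimately have "arg_min_on ?F S = w"
    unfolding arg_min_on_def arg_min_def by (rule some_equality)
  then show ?thesis by (simp add: prox_def w_def)
qed

lemma has_gradient_on_moreau_envelope:
  assumes S: "subspace S" and f: "proper_closed_convex S f" and \<sigma>: "\<sigma> > 0" and v: "v \<in> S"
  shows "has_gradient_on S (moreau_envelope S \<sigma> f) (prox S \<sigma> (fenchel_conjugate S f) (\<sigma> *\<^sub>R v)) v"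
proof -
  let ?e = "\<lambda>u. real_of_ereal (moreau_envelope S \<sigma> f u)"
  obtain p where p: "proximal_point S \<sigma> f v p" using proximal_point_exists[OF f \<sigma>] .
  define w where "w = \<sigma> *\<^sub>R (v - p)"
  have w: "prox S \<sigma> (fenchel_conjugate S f) (\<sigma> *\<^sub>R v) = w"
    using prox_fenchel_conjugate[OF S v p \<sigma>] by (simp add: w_def)
  have pS: "p \<in> S" using p by (simp add: proximal_point_def)
  obtain fp where fp: "f p = ereal fp" using p by (auto simp: proximal_point_def)
  have wS: "w \<in> S" unfolding w_def using S v pS by (intro subspace_scale subspace_diff)
  have ev: "moreau_envelope S \<sigma> f v = ereal (fp + \<sigma> / 2 * (norm (p - v))\<^sup>2)"
    using moreau_envelope_proximal_point[OF p \<sigma>] fp by simp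
  have fin: "\<bar>moreau_envelope S \<sigma> f u\<bar> \<noteq> \<infinity>" for u
  proof -
    obtain p' where p': "proximal_point S \<sigma> f u p'" using proximal_point_exists[OF f \<sigma>] .
    then show ?thesis using moreau_envelope_proximal_point[OF p' \<sigma>]
      by (auto simp: proximal_point_def)
  qed
  have bounds: "0 \<le> ?e u - ?e v - w \<bullet> (u - v) \<and> ?e u - ?e v - w \<bullet> (u - v) \<le> \<sigma> / 2 * (norm (u - v))\<^sup>2" for u
  proof -
    obtain p' where p': "proximal_point S \<sigma> f u p'" using proximal_point_exists[OF f \<sigma>] .
    obtain fp' where fp': "f p' = ereal fp'" using p' by (auto simp: proximal_point_def)
    have p'S: "p' \<in> S" using p' by (simp add: proximal_point_def)
    have eu: "moreau_envelope S \<sigma> f u = ereal (fp' + \<sigma> / 2 * (norm (p' - u))\<^sup>2)"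
      using moreau_envelope_proximal_point[OF p' \<sigma>] fp' by simp
    \<comment> \<open>The old minimizer \<open>p\<close> is a competitor in the envelope at
      \<open>u\<close>; this yields the upper bound on the remainder.\<close>
    have upper: "fp' + \<sigma> / 2 * (norm (p' - u))\<^sup>2 \<le> fp + \<sigma> / 2 * (norm (p - u))\<^sup>2"
      using INF_lower[OF pS, of "\<lambda>y. f y + ereal (\<sigma> / 2 * (norm (y - u))\<^sup>2)"]
      unfolding moreau_envelope_def[symmetric] eu fp by simp
    have wp: "w \<bullet> x = - (\<sigma> * ((p - v) \<bullet> x))" for x
      by (simp add: w_def inner_diff_left right_diff_distrib)
    have "norm (p - u) ^ 2 = norm ((p - v) - (u - v)) ^ 2" by simp
    then have 1: "\<sigma> / 2 * (norm (p - u))\<^sup>2 =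
        \<sigma> / 2 * (norm (p - v))\<^sup>2 + w \<bullet> (u - v) + \<sigma> / 2 * (norm (u - v))\<^sup>2"
      unfolding power2_norm_diff[of "p - v" "u - v"] wp by (simp add: distrib_left right_diff_distrib)
    have lower: "fp + w \<bullet> (p' - p) \<le> fp'"
      using p p'S fp fp' by (auto simp: proximal_point_def w_def)
    \<comment> \<open>Because \<open>p' - u = (p - v) - d\<close>, the square at \<open>p'\<close>
      has the linear part \<open>w \<bullet> d\<close>. Together with
      \<open>w \<bullet> (p' - p)\<close> from \<open>lower\<close> it adds up to
      \<open>w \<bullet> (u - v)\<close>, and the remaining square of \<open>d\<close> is
      nonnegative.\<close>
    define d where "d = (u - v) - (p' - p)"
    have "norm (p' - u) ^ 2 = norm ((p - v) - d) ^ 2" by (simp add: d_def)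
    then have "\<sigma> / 2 * (norm (p' - u))\<^sup>2 = \<sigma> / 2 * (norm (p - v))\<^sup>2 + w \<bullet> d + \<sigma> / 2 * (norm d)\<^sup>2"
      unfolding power2_norm_diff[of "p - v" d] wp by (simp add: distrib_left right_diff_distrib)
    moreover have "w \<bullet> d = w \<bullet> (u - v) - w \<bullet> (p' - p)" by (simp only: d_def inner_diff_right)
    moreover have "\<sigma> / 2 * (norm d)\<^sup>2 \<ge> 0" using \<sigma> by simp
    ultimately show ?thesis using upper lower 1
      unfolding eu ev real_of_ereal.simps by (intro conjI; linarith)
  qed
  have "(?e has_derivative (\<lambda>d. w \<bullet> d)) (at v within S)"
  proof (rule has_derivativeI_sandwich[where e=1 and H="\<lambda>u. \<sigma> / 2 * norm (u - v)"])
    show "((\<lambda>u. \<sigma> / 2 * norm (u - v)) \<longlongrightarrow> 0) (at v within S)"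
      by (rule tendsto_eq_intros refl | simp)+
    fix u assume "u \<noteq> v"
    have "norm (?e u - ?e v - w \<bullet> (u - v)) \<le> \<sigma> / 2 * (norm (u - v))\<^sup>2" using bounds[of u] by simp
    then show "norm (?e u - ?e v - w \<bullet> (u - v)) / norm (u - v) \<le> \<sigma> / 2 * norm (u - v)"
      using \<open>u \<noteq> v\<close> by (simp add: field_simps power2_eq_square)
  qed (auto intro: bounded_linear_inner_right)
  then show ?thesis unfolding w has_gradient_on_def using fin wS by simp
qed

subsection \<open>Linear maps and derivatives on subspaces\<close>

lemma subspace_linear_projection:
  fixes S :: "'v::euclidean_space set"
  assumes "subspace S"
  obtains P where "linear P" "\<And>x. P x \<in> S" "\<And>x. x \<in> S \<Longrightarrow> P x = x"
proof -
  have "linear (id :: 'v \<Rightarrow> 'v)" by (rule linear_id)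
  from linear_exists_left_inverse_on[OF this assms]
  obtain g where "g ` UNIV \<subseteq> S" "linear g" "\<forall>v\<in>S. g v = v" by auto
  then show ?thesis by (intro that[of g]) auto
qed

text \<open>Composition with a linear projection onto \<open>S\<close> gives a map that is linear on
  the whole type, to which the usual rules for adjoints and derivatives apply.\<close>

lemma linear_between_extension:
  fixes S :: "'v::euclidean_space set" and f :: "'v \<Rightarrow> 'w::euclidean_space"
  assumes S: "subspace S" and f: "linear_between S T f"
  obtains F where "linear F" "\<And>x. x \<in> S \<Longrightarrow> F x = f x"
proof -
  obtain P where P: "linear P" "\<And>x. P x \<in> S" "\<And>x. x \<in> S \<Longrightarrow> P x = x"
    using subspace_linear_projection[OF S] by metis
  have "linear (\<lambda>x. f (P x))"
    using f P by (intro linearI) (auto simp: linear_between_def linear_add linear_scale)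
  then show ?thesis using P(3) by (intro that[of "\<lambda>x. f (P x)"]) auto
qed

text \<open>The adjoint of a linear extension is projected orthogonally onto \<open>S\<close>; the
  discarded component is invisible to vectors of \<open>S\<close>. Uniqueness, required by the
  definite description, follows by testing the difference of two candidates against itself.\<close>

lemma adjoint_on_works:
  fixes S :: "'v::euclidean_space set" and f :: "'v \<Rightarrow> 'w::euclidean_space"
  assumes S: "subspace S" and f: "linear_between S T f"
  shows "adjoint_on S f y \<in> S \<and> (\<forall>x\<in>S. f x \<bullet> y = x \<bullet> adjoint_on S f y)"
  unfolding adjoint_on_def
proof (rule theI')
  obtain F where F: "linear F" "\<And>x. x \<in> S \<Longrightarrow> F x = f x"
    using linear_between_extension[OF S f] by metis
  obtain v z where v: "v \<in> span S" "\<And>w. w \<in> span S \<Longrightarrow> orthogonal z w" "adjoint F y = v + z"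
    using orthogonal_subspace_decomp_exists[of S "adjoint F y"] by metis
  have vS: "v \<in> S" using v(1) S by (metis span_eq_iff)
  have v2: "f x \<bullet> y = x \<bullet> v" if "x \<in> S" for x
  proof -
    have "f x \<bullet> y = x \<bullet> (v + z)" using adjoint_works[OF F(1), of x y] F(2)[OF that] v(3) by simp
    moreover have "x \<bullet> z = 0"
      using v(2)[of x] that by (simp add: span_base orthogonal_def inner_commute)
    ultimately show ?thesis by (simp add: inner_add_right)
  qed
  show "\<exists>!v. v \<in> S \<and> (\<forall>x\<in>S. f x \<bullet> y = x \<bullet> v)"
  proof (rule ex1I[of _ v])
    fix v' assume v': "v' \<in> S \<and> (\<forall>x\<in>S. f x \<bullet> y = x \<bullet> v')"
    have "v' - v \<in> S" using v' vS S by (simp add: subspace_diff)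
    then have "(v' - v) \<bullet> (v' - v) = 0"
      using v' v2 by (simp add: inner_diff_right)
    then show "v' = v" by simp
  qed (use vS v2 in auto)
qed

lemma linear_between_sum:
  assumes "linear_between S T f" "x \<in> S" "y \<in> S" "subspace S"
  shows "f (u *\<^sub>R x + v *\<^sub>R y) = u *\<^sub>R f x + v *\<^sub>R f y"
  using assms by (simp add: linear_between_def subspace_scale)

text \<open>Increments between points of \<open>S\<close> stay in \<open>S\<close>, so the limit
  sees a derivative only through its values on \<open>S\<close>. This allows a derivative obtained
  from ambient extensions to be exchanged for the inner product with a gradient.\<close>

lemma has_derivative_within_subspace_cong:
  fixes f :: "'v::real_normed_vector \<Rightarrow> 'w::real_normed_vector"
  assumes f: "(f has_derivative f') (at x within S)" and S: "subspace S" "x \<in> S"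
    and g': "bounded_linear g'" and eq: "\<And>d. d \<in> S \<Longrightarrow> f' d = g' d"
  shows "(f has_derivative g') (at x within S)"
  unfolding has_derivative_within
proof
  have "((\<lambda>y. (1 / norm (y - x)) *\<^sub>R (f y - (f x + f' (y - x)))) \<longlongrightarrow> 0) (at x within S)"
    using f by (simp add: has_derivative_within)
  then show "((\<lambda>y. (1 / norm (y - x)) *\<^sub>R (f y - (f x + g' (y - x)))) \<longlongrightarrow> 0) (at x within S)"
    by (rule Lim_transform_within[OF _ zero_less_one]) (simp add: eq S subspace_diff)
qed (rule g')

lemma block_space_subspace:
  assumes "\<And>i. subspace (X i)"
  shows "subspace (block_space X J)"
  using assms by (auto simp: subspace_def block_space_def)

lemma inner_block_space:
  assumes "u \<in> block_space X J"
  shows "u \<bullet> v = (\<Sum>i\<in>J. u $ i \<bullet> v $ i)"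
  unfolding inner_vec_def using assms
  by (intro sum.mono_neutral_right) (auto simp: block_space_def)

lemma sum_ereal_eq:
  assumes "\<And>i. i \<in> J \<Longrightarrow> f i = ereal (g i)"
  shows "(\<Sum>i\<in>J. f i) = ereal (\<Sum>i\<in>J. g i)"
  using assms by (simp flip: sum_ereal)

lemma has_gradient_on_compose:
  assumes g: "has_gradient_on S f g (l x)" and l: "(l has_derivative l') (at x within W)"
    and sub: "l ` W \<subseteq> S"
  shows "((\<lambda>w. real_of_ereal (f (l w))) has_derivative (\<lambda>d. g \<bullet> l' d)) (at x within W)"
proof -
  have "((\<lambda>u. real_of_ereal (f u)) has_derivative (\<lambda>d. g \<bullet> d)) (at (l x) within l ` W)"
    using g sub unfolding has_gradient_on_def by (blast intro: has_derivative_subset)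
  from has_derivative_in_compose[OF l this] show ?thesis .
qed

lemma linear_affine_has_derivative:
  fixes L :: "'v::euclidean_space \<Rightarrow> 'w::euclidean_space"
  assumes "linear L"
  shows "((\<lambda>w. c + L w) has_derivative L) F"
proof -
  have "bounded_linear L" using assms by (simp add: linear_conv_bounded_linear)
  then have "(L has_derivative L) F" by (rule bounded_linear_imp_has_derivative)
  from has_derivative_add[OF has_derivative_const this, of c] show ?thesis by simp
qed

subsection \<open>The gradient of the reduced augmented Lagrangian\<close>

locale block_problem =
  fixes X :: "'m::finite \<Rightarrow> 'a::euclidean_space set"
    and h :: "'m \<Rightarrow> 'a \<Rightarrow> ereal"
    and A :: "'m \<Rightarrow> 'a \<Rightarrow> 'a"
    and b :: 'a and \<sigma> :: real and I1 :: "'m set" and n :: 'm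
  assumes n: "n \<notin> I1"
    and X: "\<And>i. subspace (X i)"
    and A: "\<And>i. i \<noteq> n \<Longrightarrow> linear_between (X i) (X n) (A i)"
    and b: "b \<in> X n"
    and finite_I1: "\<And>i x. i \<in> I1 \<Longrightarrow> x \<in> X i \<Longrightarrow> \<bar>h i x\<bar> \<noteq> \<infinity>"
    and convex_I1: "\<And>i. i \<in> I1 \<Longrightarrow> convex_on (X i) (\<lambda>x. real_of_ereal (h i x))"
    and gradient_I1: "\<And>i x. i \<in> I1 \<Longrightarrow> x \<in> X i \<Longrightarrow> has_gradient_on (X i) (h i) (gradient_on (X i) (h i) x) x"
    and proper_I2: "\<And>i. i \<notin> I1 \<Longrightarrow> proper_closed_convex (X i) (h i)"
    and \<sigma>: "\<sigma> > 0"
begin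

lemma h_not_MInf: "v \<in> X i \<Longrightarrow> h i v \<noteq> -\<infinity>"
  using finite_I1[of i v] proper_I2[of i] by (cases "i \<in> I1") (auto simp: proper_closed_convex_def)

lemma A_in: "i \<noteq> n \<Longrightarrow> v \<in> X i \<Longrightarrow> A i v \<in> X n"
  using A[of i] by (auto simp: linear_between_def)

lemma adjoint_A_in: "i \<noteq> n \<Longrightarrow> adjoint_on (X i) (A i) y \<in> X i"
  using adjoint_on_works[OF X A] by blast

lemma adjoint_A: "i \<noteq> n \<Longrightarrow> v \<in> X i \<Longrightarrow> adjoint_on (X i) (A i) y \<bullet> v = A i v \<bullet> y"
  using adjoint_on_works[OF X A] by (metis inner_commute)

lemma moreau_gradient:
  assumes "i \<notin> I1" "v \<in> X i"
  shows "has_gradient_on (X i) (moreau_envelope (X i) \<sigma> (h i))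
    (prox (X i) \<sigma> (fenchel_conjugate (X i) (h i)) (\<sigma> *\<^sub>R v)) v"
  using has_gradient_on_moreau_envelope[OF X proper_I2 \<sigma>] assms by blast

lemma sum_not_n: "(\<Sum>i\<in>-{n}. f i) = (\<Sum>i\<in>I1. f i) + (\<Sum>i\<in>-I1 - {n}. f i)"
  for f :: "'m \<Rightarrow> 'b::comm_monoid_add"
proof -
  have "-{n} = I1 \<union> (-I1 - {n})" using n by auto
  then show ?thesis by (metis Diff_disjoint Diff_eq_empty_iff Int_Diff finite sum.union_disjoint
    Compl_disjoint empty_Diff)
qed

lemma sum_I2: "(\<Sum>i\<in>-I1. f i) = f n + (\<Sum>i\<in>-I1 - {n}. f i)"
  for f :: "'m \<Rightarrow> 'b::comm_monoid_add"
  using n by (simp add: sum.remove)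

text \<open>In its closed form \<open>Phi\<close> is a sum of smooth terms, envelopes of affine
  functions of \<open>w\<close> and a quadratic. Each summand is differentiated by the chain rule,
  and the adjoints appear when the result is sorted by blocks of the increment.\<close>

lemma Phi_has_gradient:
  assumes x: "x \<in> block_space X (-{n})" and z: "z \<in> block_space X (-I1)"
  defines "p \<equiv> (\<lambda>i. prox (X i) \<sigma> (fenchel_conjugate (X i) (h i)) (\<sigma> *\<^sub>R x $ i - z $ i))"
    and "pn \<equiv> prox (X n) \<sigma> (fenchel_conjugate (X n) (h n))
      (\<sigma> *\<^sub>R b - z $ n - \<sigma> *\<^sub>R (\<Sum>j\<in>-{n}. A j (x $ j)))"
  shows "has_gradient_on (block_space X (-{n}) \<times> block_space X (-I1)) (Phi X h A b \<sigma> I1 n)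
    (\<chi> i. if i = n then 0 else
        (if i \<in> I1 then gradient_on (X i) (h i) (x $ i) else p i) - adjoint_on (X i) (A i) pn,
     \<chi> i. if i \<in> I1 then 0 else
        - (1 / \<sigma>) *\<^sub>R z $ i - (1 / \<sigma>) *\<^sub>R (if i = n then pn else p i)) (x, z)"
    (is "has_gradient_on (?Sx \<times> ?Sz) _ (?gx, ?gz) _")
proof -
  let ?W = "?Sx \<times> ?Sz" and ?J = "-I1 - {n}"
  let ?e = "\<lambda>i. moreau_envelope (X i) \<sigma> (h i)"
  let ?g = "\<lambda>i. gradient_on (X i) (h i) (x $ i)"
  have W: "subspace ?W" by (intro subspace_Times block_space_subspace X)
  have Xw: "fst w $ i \<in> X i" "snd w $ i \<in> X i" if "w \<in> ?W" for w i
    using that subspace_0[OF X] by (cases "i = n"; cases "i \<in> I1"; auto simp: block_space_def)+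
  have "\<exists>F. linear F \<and> (\<forall>v\<in>X i. F v = A i v)" if "i \<noteq> n" for i
    using linear_between_extension[OF X A[OF that]] by metis
  then obtain F where F: "\<And>i. i \<noteq> n \<Longrightarrow> linear (F i)" "\<And>i v. i \<noteq> n \<Longrightarrow> v \<in> X i \<Longrightarrow> F i v = A i v"
    by metis
  define u where "u i w = fst w $ i - snd w $ i /\<^sub>R \<sigma>" for i and w :: "('a^'m) \<times> ('a^'m)"
  \<comment> \<open>The maps \<open>u i\<close> and \<open>Ln\<close> are the linear parts of the
    envelope arguments. The extensions \<open>F i\<close> in place of \<open>A i\<close> make
    \<open>Ln\<close> linear on the whole type, without changing it on \<open>?W\<close>.\<close>
  define Ln where "Ln w = - (snd w $ n /\<^sub>R \<sigma>) - (\<Sum>i\<in>-{n}. F i (fst w $ i))" for w :: "('a^'m) \<times> ('a^'m)"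
  have un: "b + Ln w = b - snd w $ n /\<^sub>R \<sigma> - (\<Sum>i\<in>-{n}. A i (fst w $ i))" if "w \<in> ?W" for w
    using F(2) Xw[OF that] by (simp add: Ln_def)
  have u_in: "u i w \<in> X i" if "w \<in> ?W" for i w
    unfolding u_def using Xw[OF that] by (intro subspace_diff X subspace_scale)
  have un_in: "b + Ln w \<in> X n" if "w \<in> ?W" for w
    unfolding un[OF that] using Xw[OF that] b
    by (intro subspace_diff X subspace_scale subspace_sum A_in) auto
  \<comment> \<open>A real-valued version of the closed form, to which the differentiation rules
    apply; it represents \<open>Phi\<close> on \<open>?W\<close>.\<close>
  define R where "R w = (\<Sum>i\<in>I1. real_of_ereal (h i (fst w $ i))) + (\<Sum>i\<in>?J. real_of_ereal (?e i (u i w)))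
    + real_of_ereal (?e n (b + Ln w)) - 1 / (2 * \<sigma>) * (\<Sum>i\<in>-I1. (norm (snd w $ i))\<^sup>2)"
    for w :: "('a^'m) \<times> ('a^'m)"
  have fin: "\<bar>?e i v\<bar> \<noteq> \<infinity>" if "i \<notin> I1" "v \<in> X i" for i v
    using moreau_gradient[OF that] that by (simp add: has_gradient_on_def)
  have Phi: "Phi X h A b \<sigma> I1 n w = ereal (R w)" if w: "w \<in> ?W" for w
  proof -
    have 1: "(\<Sum>i\<in>I1. h i (fst w $ i)) = ereal (\<Sum>i\<in>I1. real_of_ereal (h i (fst w $ i)))"
      using finite_I1 Xw[OF w] by (intro sum_ereal_eq) (simp add: ereal_real)
    have 2: "(\<Sum>i\<in>?J. ?e i (u i w)) = ereal (\<Sum>i\<in>?J. real_of_ereal (?e i (u i w)))"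
      using fin u_in[OF w] by (intro sum_ereal_eq) (simp add: ereal_real)
    have 3: "?e n (b + Ln w) = ereal (real_of_ereal (?e n (b + Ln w)))"
      using fin[OF n un_in[OF w]] by (simp add: ereal_real)
    have "Phi X h A b \<sigma> I1 n (fst w, snd w) = (\<Sum>i\<in>I1. h i (fst w $ i)) + (\<Sum>i\<in>?J. ?e i (u i w))
      + ?e n (b + Ln w) - ereal (1 / (2 * \<sigma>) * (\<Sum>i\<in>-I1. (norm (snd w $ i))\<^sup>2))"
      unfolding un[OF w] u_def
    proof (rule Phi_eq_moreau_envelopes)
      show "X i \<noteq> {}" for i using subspace_0[OF X] by blast
    qed (use n h_not_MInf finite_I1 Xw[OF w] in auto)
    also have "\<dots> = ereal (R w)" unfolding R_def 1 2 by (subst 3) simp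
    finally show ?thesis by simp
  qed
  have xz: "(x, z) \<in> ?W" using x z by simp
  have linear_u: "linear (u i)" for i
    by (rule linearI) (simp_all add: u_def algebra_simps)
  have linear_Ln: "linear Ln"
    by (rule linearI)
      (simp_all add: Ln_def linear_add[OF F(1)] linear_scale[OF F(1)] sum.distrib
        scaleR_sum_right algebra_simps)
  have linear_fst: "linear (\<lambda>w::('a^'m) \<times> ('a^'m). fst w $ i)" for i
    by (rule linearI) simp_all
  have linear_snd: "linear (\<lambda>w::('a^'m) \<times> ('a^'m). snd w $ i)" for i
    by (rule linearI) simp_all
  have d1: "((\<lambda>w. real_of_ereal (h i (fst w $ i))) has_derivative (\<lambda>d. ?g i \<bullet> fst d $ i)) (at (x, z) within ?W)"
    if "i \<in> I1" for i
  proof (rule has_gradient_on_compose)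
    show "has_gradient_on (X i) (h i) (?g i) (fst (x, z) $ i)"
      using gradient_I1[OF that Xw(1)[OF xz]] by simp
    show "((\<lambda>w. fst w $ i) has_derivative (\<lambda>d. fst d $ i)) (at (x, z) within ?W)"
      using linear_affine_has_derivative[OF linear_fst, of 0] by simp
  qed (use Xw in blast)
  \<comment> \<open>The proximal argument is \<sigma> times the envelope argument, as the gradient
    formula of the envelope demands.\<close>
  have p: "p i = prox (X i) \<sigma> (fenchel_conjugate (X i) (h i)) (\<sigma> *\<^sub>R u i (x, z))" for i
    using \<sigma> by (simp add: p_def u_def algebra_simps)
  have d2: "((\<lambda>w. real_of_ereal (?e i (u i w))) has_derivative (\<lambda>d. p i \<bullet> u i d)) (at (x, z) within ?W)"
    if "i \<in> ?J" for i
  proof (rule has_gradient_on_compose)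
    show "has_gradient_on (X i) (?e i) (p i) (u i (x, z))"
      unfolding p using moreau_gradient u_in[OF xz] that by blast
    show "(u i has_derivative u i) (at (x, z) within ?W)"
      using linear_affine_has_derivative[OF linear_u, of 0 i] by simp
  qed (use u_in in blast)
  have pn: "pn = prox (X n) \<sigma> (fenchel_conjugate (X n) (h n)) (\<sigma> *\<^sub>R (b + Ln (x, z)))"
    unfolding un[OF xz] pn_def using \<sigma> by (simp add: scaleR_diff_right)
  have d3: "((\<lambda>w. real_of_ereal (?e n (b + Ln w))) has_derivative (\<lambda>d. pn \<bullet> Ln d)) (at (x, z) within ?W)"
  proof (rule has_gradient_on_compose)
    show "has_gradient_on (X n) (?e n) pn (b + Ln (x, z))"
      unfolding pn using moreau_gradient un_in[OF xz] n by blast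
    show "((\<lambda>w. b + Ln w) has_derivative Ln) (at (x, z) within ?W)"
      by (rule linear_affine_has_derivative[OF linear_Ln])
  qed (use un_in in blast)
  have d4: "((\<lambda>w. (norm (snd w $ i))\<^sup>2) has_derivative (\<lambda>d. 2 * (z $ i \<bullet> snd d $ i))) (at (x, z) within ?W)" for i
  proof -
    have "((\<lambda>w. snd w $ i) has_derivative (\<lambda>d. snd d $ i)) (at (x, z) within ?W)"
      using linear_affine_has_derivative[OF linear_snd, of 0] by simp
    from has_derivative_inner[OF this this] show ?thesis
      by (simp add: power2_norm_eq_inner inner_commute)
  qed
  let ?D = "\<lambda>d. (\<Sum>i\<in>I1. ?g i \<bullet> fst d $ i) + (\<Sum>i\<in>?J. p i \<bullet> u i d) + pn \<bullet> Ln d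
      - 1 / (2 * \<sigma>) * (\<Sum>i\<in>-I1. 2 * (z $ i \<bullet> snd d $ i))"
  have "(R has_derivative ?D) (at (x, z) within ?W)"
    unfolding R_def
    by (intro has_derivative_diff has_derivative_add has_derivative_sum has_derivative_mult_right d1 d2 d3 d4)
  \<comment> \<open>The two linear forms agree on \<open>?W\<close> only, because \<open>F i\<close>
    coincides with \<open>A i\<close> and \<open>adjoint_on\<close> acts as its adjoint just on
    \<open>X i\<close>.\<close>
  then have "(R has_derivative (\<lambda>d. (?gx, ?gz) \<bullet> d)) (at (x, z) within ?W)"
  proof (rule has_derivative_within_subspace_cong[OF _ W xz bounded_linear_inner_right])
    fix d assume d: "d \<in> ?W"
    obtain d1 d2 where d12: "d = (d1, d2)" by fastforce
    have Xd: "d1 $ i \<in> X i" for i using Xw[OF d] d12 by simp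
    have "?gx \<bullet> d1 = d1 \<bullet> ?gx" by (rule inner_commute)
    also have "\<dots> = (\<Sum>i\<in>-{n}. d1 $ i \<bullet> ?gx $ i)"
      using d d12 by (intro inner_block_space[of _ X]) simp
    also have "\<dots> = (\<Sum>i\<in>-{n}. (if i \<in> I1 then ?g i else p i) \<bullet> d1 $ i - A i (d1 $ i) \<bullet> pn)"
      using adjoint_A Xd
      by (intro sum.cong) (auto simp: inner_diff_right inner_commute)
    also have "\<dots> = (\<Sum>i\<in>I1. ?g i \<bullet> d1 $ i) + (\<Sum>i\<in>?J. p i \<bullet> d1 $ i) - (\<Sum>i\<in>-{n}. A i (d1 $ i) \<bullet> pn)"
      unfolding sum_subtractf sum_not_n[of "\<lambda>i. (if i \<in> I1 then ?g i else p i) \<bullet> d1 $ i"] by simp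
    also have "(\<Sum>i\<in>-{n}. A i (d1 $ i) \<bullet> pn) = pn \<bullet> (\<Sum>i\<in>-{n}. F i (d1 $ i))"
      using F(2) Xd by (simp add: inner_sum_right inner_commute)
    finally have gx: "?gx \<bullet> d1 = (\<Sum>i\<in>I1. ?g i \<bullet> d1 $ i) + (\<Sum>i\<in>?J. p i \<bullet> d1 $ i)
        - pn \<bullet> (\<Sum>i\<in>-{n}. F i (d1 $ i))" .
    have "?gz \<bullet> d2 = d2 \<bullet> ?gz" by (rule inner_commute)
    also have "\<dots> = (\<Sum>i\<in>-I1. d2 $ i \<bullet> ?gz $ i)"
      using d d12 by (intro inner_block_space[of _ X]) simp
    also have "\<dots> = (\<Sum>i\<in>-I1. - (1 / \<sigma>) * (z $ i \<bullet> d2 $ i) - (1 / \<sigma>) * ((if i = n then pn else p i) \<bullet> d2 $ i))"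
      by (intro sum.cong) (auto simp: inner_diff_right inner_commute)
    also have "\<dots> = - (1 / \<sigma>) * (\<Sum>i\<in>-I1. z $ i \<bullet> d2 $ i)
        - (1 / \<sigma>) * (\<Sum>i\<in>-I1. (if i = n then pn else p i) \<bullet> d2 $ i)"
      by (simp only: sum_subtractf sum_distrib_left)
    also have "(\<Sum>i\<in>-I1. (if i = n then pn else p i) \<bullet> d2 $ i) = pn \<bullet> d2 $ n + (\<Sum>i\<in>?J. p i \<bullet> d2 $ i)"
      unfolding sum_I2 by simp
    finally have gz: "?gz \<bullet> d2 = - (1 / \<sigma>) * (\<Sum>i\<in>-I1. z $ i \<bullet> d2 $ i)
        - (1 / \<sigma>) * (pn \<bullet> d2 $ n + (\<Sum>i\<in>?J. p i \<bullet> d2 $ i))" .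
    have 1: "(\<Sum>i\<in>?J. p i \<bullet> u i d) = (\<Sum>i\<in>?J. p i \<bullet> d1 $ i) - (1 / \<sigma>) * (\<Sum>i\<in>?J. p i \<bullet> d2 $ i)"
      unfolding u_def d12 by (simp add: inner_diff_right sum_subtractf sum_distrib_left divide_inverse mult.commute)
    have 2: "pn \<bullet> Ln d = - ((1 / \<sigma>) * (pn \<bullet> d2 $ n)) - pn \<bullet> (\<Sum>i\<in>-{n}. F i (d1 $ i))"
      unfolding Ln_def d12 by (simp add: inner_diff_right divide_inverse mult.commute)
    have 3: "1 / (2 * \<sigma>) * (\<Sum>i\<in>-I1. 2 * (z $ i \<bullet> snd d $ i)) = 1 / \<sigma> * (\<Sum>i\<in>-I1. z $ i \<bullet> d2 $ i)"
      unfolding d12 using \<sigma> by (simp flip: sum_distrib_left)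
    show "?D d = (?gx, ?gz) \<bullet> d"
      unfolding 1 2 3 unfolding d12 inner_Pair gx gz fst_conv by (simp add: distrib_left)
  qed
  then have "((\<lambda>w. real_of_ereal (Phi X h A b \<sigma> I1 n w)) has_derivative (\<lambda>d. (?gx, ?gz) \<bullet> d)) (at (x, z) within ?W)"
    by (rule has_derivative_transform[OF xz, rotated]) (simp add: Phi)
  moreover have "?gx \<in> ?Sx"
  proof -
    have "?g i \<in> X i" if "i \<in> I1" for i
      using gradient_I1[OF that Xw(1)[OF xz]] by (simp add: has_gradient_on_def)
    moreover have "p i \<in> X i" if "i \<in> ?J" for i
      using moreau_gradient[of i, OF _ u_in[OF xz]] that by (simp add: has_gradient_on_def p)
    ultimately show ?thesis
      using adjoint_A_in by (auto simp: block_space_def intro!: subspace_diff X)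
  qed
  moreover have "?gz \<in> ?Sz"
  proof -
    have "p i \<in> X i" if "i \<in> ?J" for i
      using moreau_gradient[of i, OF _ u_in[OF xz]] that by (simp add: has_gradient_on_def p)
    moreover have "pn \<in> X n"
      using moreau_gradient[OF n un_in[OF xz]] by (simp add: has_gradient_on_def pn)
    ultimately show ?thesis
      using z by (auto simp: block_space_def intro!: subspace_diff subspace_neg subspace_scale X)
  qed
  ultimately show ?thesis
    unfolding has_gradient_on_def using Phi by auto
qed

end

subsection \<open>Strong duality\<close>

lemma convex_ereal_epigraph:
  assumes "convex_on S (\<lambda>x. real_of_ereal (f x))" "\<And>x. x \<in> S \<Longrightarrow> \<bar>f x\<bar> \<noteq> \<infinity>"
  shows "convex (ereal_epigraph S f)"
proof -
  have "f x \<le> ereal r \<longleftrightarrow> real_of_ereal (f x) \<le> r" if "x \<in> S" for x r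
    using assms(2)[OF that] by (cases "f x") auto
  then have "ereal_epigraph S f = epigraph S (\<lambda>x. real_of_ereal (f x))"
    by (auto simp: ereal_epigraph_def epigraph_def)
  then show ?thesis using convex_epigraphI[OF assms(1)] by simp
qed

text \<open>The domain is the projection of the epigraph, and linear images of convex sets are
  convex.\<close>

lemma convex_effective_domain:
  assumes "convex (ereal_epigraph S f)"
  shows "convex (effective_domain S f)"
proof -
  have "effective_domain S f = fst ` ereal_epigraph S f"
  proof (intro set_eqI iffI)
    fix x assume "x \<in> effective_domain S f"
    then have x: "x \<in> S" "f x < \<infinity>" by (auto simp: effective_domain_def)
    then have "f x \<le> ereal (real_of_ereal (f x))" by (cases "f x") auto
    with x have "(x, real_of_ereal (f x)) \<in> ereal_epigraph S f" by (simp add: ereal_epigraph_def)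
    then show "x \<in> fst ` ereal_epigraph S f" by force
  next
    fix x assume "x \<in> fst ` ereal_epigraph S f"
    then obtain r where "x \<in> S" "f x \<le> ereal r" by (auto simp: ereal_epigraph_def)
    then show "x \<in> effective_domain S f" by (auto simp: effective_domain_def)
  qed
  then show ?thesis using convex_linear_image[OF linear_fst assms] by simp
qed

section \<open>Lagrange multipliers from Slater's condition\<close>

context block_problem
begin

text \<open>Smooth and nonsmooth terms are brought to a common form, so that the separation argument
  can treat all blocks alike.\<close>

lemma convex_epigraph_h: "convex (ereal_epigraph (X i) (h i))"
  using convex_ereal_epigraph[OF convex_I1 finite_I1] proper_I2[of i]
  by (cases "i \<in> I1") (auto simp: proper_closed_convex_def)

definition residual :: "'a ^ 'm \<Rightarrow> 'a" where
  "residual u = (\<Sum>i\<in>-{n}. A i (u $ i)) + u $ n - b"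

lemma residual_convex_combination:
  assumes "u \<in> block_space X UNIV" "v \<in> block_space X UNIV" "s + t = 1"
  shows "residual (s *\<^sub>R u + t *\<^sub>R v) = s *\<^sub>R residual u + t *\<^sub>R residual v"
proof -
  have "(\<Sum>i\<in>-{n}. A i ((s *\<^sub>R u + t *\<^sub>R v) $ i)) = (\<Sum>i\<in>-{n}. s *\<^sub>R A i (u $ i) + t *\<^sub>R A i (v $ i))"
    using assms by (intro sum.cong refl)
      (auto simp: block_space_def intro!: linear_between_sum[OF A _ _ X])
  moreover have "b = s *\<^sub>R b + t *\<^sub>R b" using assms(3) by (metis scaleR_add_left scaleR_one)
  ultimately show ?thesis
    by (simp add: residual_def sum.distrib scaleR_sum_right algebra_simps)
qed

lemma residual_in: "u \<in> block_space X UNIV \<Longrightarrow> residual u \<in> X n"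
  unfolding residual_def
  by (intro subspace_diff subspace_add subspace_sum X A_in b) (auto simp: block_space_def)

lemma feasible_iff: "u \<in> P_feasible X A b n \<longleftrightarrow> u \<in> block_space X UNIV \<and> residual u = 0"
  by (auto simp: P_feasible_def residual_def)

text \<open>No summand is \<open>-\<infinity>\<close>, so the sum is infinite exactly when some
  summand is; the equation on the right encodes finiteness of a summand.\<close>

lemma P_objective_finite_iff:
  assumes "u \<in> block_space X UNIV"
  shows "P_objective h u \<noteq> \<infinity> \<longleftrightarrow> (\<forall>i. h i (u $ i) = ereal (real_of_ereal (h i (u $ i))))"
proof -
  have "h i (u $ i) \<noteq> -\<infinity>" for i using assms h_not_MInf by (simp add: block_space_def)
  then have "(h i (u $ i) = ereal (real_of_ereal (h i (u $ i)))) \<longleftrightarrow> h i (u $ i) \<noteq> \<infinity>" for i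
    by (metis ereal_real' PInfty_neq_ereal(1) abs_ereal.simps ereal_infinity_cases)
  then show ?thesis by (simp add: P_objective_def sum_Pinfty)
qed

lemma P_objective_real:
  assumes "\<And>i. h i (u $ i) = ereal (real_of_ereal (h i (u $ i)))"
  shows "P_objective h u = ereal (\<Sum>i\<in>UNIV. real_of_ereal (h i (u $ i)))"
  unfolding P_objective_def by (rule sum_ereal_eq) (rule assms)

text \<open>A segment ending in the relative interior of a convex set can be prolonged a little
  beyond its end. Each block allows its own factor, and the least of these finitely many factors
  serves all blocks at once.\<close>

lemma slater_line:
  assumes ub: "\<And>i. ub $ i \<in> rel_interior (effective_domain (X i) (h i))"
    and u: "\<And>i. u $ i \<in> effective_domain (X i) (h i)"
  obtains e where "e > 1" "\<And>i. ((1 - e) *\<^sub>R u + e *\<^sub>R ub) $ i \<in> effective_domain (X i) (h i)"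
proof -
  have "\<exists>m>1. \<forall>e. e > 1 \<and> e \<le> m \<longrightarrow> (1 - e) *\<^sub>R u $ i + e *\<^sub>R ub $ i \<in> effective_domain (X i) (h i)" for i
    using convex_rel_interior_if[OF convex_effective_domain[OF convex_epigraph_h] ub] u
    by (meson hull_inc)
  then obtain m where m: "\<And>i. m i > (1::real)"
    "\<And>i e. e > 1 \<and> e \<le> m i \<Longrightarrow> (1 - e) *\<^sub>R u $ i + e *\<^sub>R ub $ i \<in> effective_domain (X i) (h i)"
    by metis
  have "Min (range m) > 1" using m(1) by simp
  moreover have "Min (range m) \<le> m i" for i by simp
  ultimately show ?thesis using m(2) by (intro that[of "Min (range m)"]) auto
qed

text \<open>The set \<open>C\<close> collects the pairs of a constraint violation and an upper bound
  for the objective there, much like the epigraph of the value function of the perturbed problem. It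
  is convex, and \<open>p\<close> is its least height above 0, so it has a supporting hyperplane at
  \<open>(0, p)\<close>.\<close>

lemma lagrange_multiplier_exists:
  assumes opt: "xo \<in> P_feasible X A b n" "\<And>u. u \<in> P_feasible X A b n \<Longrightarrow> P_objective h xo \<le> P_objective h u"
    and ub: "ub \<in> P_feasible X A b n" "\<And>i. ub $ i \<in> rel_interior (effective_domain (X i) (h i))"
  shows "\<exists>p l. P_objective h xo = ereal p \<and> l \<in> X n \<and>
    (\<forall>u\<in>block_space X UNIV. (\<forall>i. h i (u $ i) = ereal (real_of_ereal (h i (u $ i)))) \<longrightarrow>
      p \<le> (\<Sum>i\<in>UNIV. real_of_ereal (h i (u $ i))) + residual u \<bullet> l)"
proof -
  let ?E = "\<lambda>i. ereal_epigraph (X i) (h i)" and ?r = "\<lambda>u i. real_of_ereal (h i (u $ i))"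
  \<comment> \<open>The heights \<open>r i\<close> are arbitrary upper bounds for the values of
    \<open>h i\<close>, not the values themselves; this makes \<open>C\<close> convex and closed
    upwards.\<close>
  define C where "C = {(residual u, \<Sum>i\<in>UNIV. r i) | u r. \<forall>i. (u $ i, r i) \<in> ?E i}"
  have E_block: "u \<in> block_space X UNIV" if "\<forall>i. (u $ i, r i) \<in> ?E i" for u r
    using that by (auto simp: ereal_epigraph_def block_space_def)
  have in_E: "\<forall>i. (u $ i, ?r u i) \<in> ?E i"
    if "u \<in> block_space X UNIV" "\<And>i. h i (u $ i) = ereal (?r u i)" for u
    using that by (auto simp: ereal_epigraph_def block_space_def simp flip: that(2))
  have dom_finite: "u \<in> block_space X UNIV \<and> (\<forall>i. h i (u $ i) = ereal (?r u i))"
    if "\<And>i. u $ i \<in> effective_domain (X i) (h i)" for u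
  proof -
    have u: "u \<in> block_space X UNIV" using that by (auto simp: effective_domain_def block_space_def)
    moreover have "P_objective h u \<noteq> \<infinity>"
      using that by (auto simp: P_objective_def sum_Pinfty effective_domain_def)
    ultimately show ?thesis using P_objective_finite_iff by blast
  qed
  have ub_dom: "ub $ i \<in> effective_domain (X i) (h i)" for i
    using ub(2) rel_interior_subset by blast
  note ubf = dom_finite[OF ub_dom]
  have xo: "xo \<in> block_space X UNIV" "residual xo = 0" using opt(1) by (auto simp: feasible_iff)
  \<comment> \<open>The Slater point is feasible with finite objective, which bounds the optimal
    value from above.\<close>
  have "P_objective h xo \<noteq> \<infinity>" using opt(2)[OF ub(1)] P_objective_real[of ub] ubf by auto
  then have xof: "\<And>i. h i (xo $ i) = ereal (?r xo i)" using P_objective_finite_iff[OF xo(1)] by blast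
  define p where "p = (\<Sum>i\<in>UNIV. ?r xo i)"
  have p: "P_objective h xo = ereal p" unfolding p_def by (rule P_objective_real[OF xof])
  have "convex C"
  proof (rule convexI)
    fix c d and s t :: real assume "c \<in> C" "d \<in> C" and st: "0 \<le> s" "0 \<le> t" "s + t = 1"
    then obtain u r v q where c: "c = (residual u, sum r UNIV)" "\<forall>i. (u $ i, r i) \<in> ?E i"
      and d: "d = (residual v, sum q UNIV)" "\<forall>i. (v $ i, q i) \<in> ?E i"
      unfolding C_def by blast
    have "\<forall>i. ((s *\<^sub>R u + t *\<^sub>R v) $ i, s * r i + t * q i) \<in> ?E i"
    proof
      fix i
      have "s *\<^sub>R (u $ i, r i) + t *\<^sub>R (v $ i, q i) \<in> ?E i"
        using convex_epigraph_h[of i] c(2) d(2) st by (meson convexD)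
      then show "((s *\<^sub>R u + t *\<^sub>R v) $ i, s * r i + t * q i) \<in> ?E i" by simp
    qed
    moreover have "s *\<^sub>R c + t *\<^sub>R d = (residual (s *\<^sub>R u + t *\<^sub>R v), \<Sum>i\<in>UNIV. s * r i + t * q i)"
      using c d E_block st residual_convex_combination[of u v s t]
      by (simp add: sum.distrib sum_distrib_left)
    ultimately show "s *\<^sub>R c + t *\<^sub>R d \<in> C" unfolding C_def by blast
  qed
  have C_up: "(w, r + e) \<in> C" if "(w, r) \<in> C" "e \<ge> 0" for w r e
  proof -
    from that obtain u q where u: "w = residual u" "r = sum q UNIV" "\<forall>i. (u $ i, q i) \<in> ?E i"
      unfolding C_def by blast
    \<comment> \<open>The extra height is put entirely into block \<open>n\<close>; any single block
      would do.\<close>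
    let ?q = "\<lambda>i. q i + (if i = n then e else 0)"
    have "\<forall>i. (u $ i, ?q i) \<in> ?E i"
    proof
      fix i
      have "h i (u $ i) \<le> ereal (q i)" "u $ i \<in> X i" using u(3) by (auto simp: ereal_epigraph_def)
      moreover have "ereal (q i) \<le> ereal (?q i)" using that by simp
      ultimately show "(u $ i, ?q i) \<in> ?E i" by (auto simp: ereal_epigraph_def intro: order_trans)
    qed
    moreover have "r + e = sum ?q UNIV" using u(2) by (simp add: sum.distrib)
    ultimately show ?thesis unfolding C_def u(1) by blast
  qed
  have pC: "(0, p) \<in> C"
    unfolding C_def p_def using in_E[OF xo(1) xof] xo(2) by force
  have p_min: "p \<le> r" if "(0, r) \<in> C" for r
  proof -
    from that obtain u q where u: "residual u = 0" "r = sum q UNIV" "\<forall>i. (u $ i, q i) \<in> ?E i"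
      unfolding C_def by force
    have "P_objective h xo \<le> P_objective h u"
      using u E_block by (intro opt(2)) (auto simp: feasible_iff)
    also have "\<dots> \<le> (\<Sum>i\<in>UNIV. ereal (q i))"
      unfolding P_objective_def using u(3) by (intro sum_mono) (auto simp: ereal_epigraph_def)
    finally show ?thesis using u(2) p by simp
  qed
  txt \<open>A hyperplane supporting \<open>C\<close> at \<open>(0, p)\<close> without containing \<open>C\<close> has as slope the multiplier;
    Slater's condition excludes a vertical one.\<close>
  have "(0, p) \<notin> rel_interior C"
  proof
    assume "(0, p) \<in> rel_interior C"
    moreover have "(0, p + 1) \<in> affine hull C" using C_up[OF pC, of 1] by (simp add: hull_inc)
    \<comment> \<open>From a relative interior point, the segment that descends from
      \<open>(0, p + 1)\<close> could be prolonged to a point of \<open>C\<close> above 0 with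
      height less than \<open>p\<close>.\<close>
    ultimately obtain e where e: "e > 1" "(1 - e) *\<^sub>R (0, p + 1) + e *\<^sub>R (0, p) \<in> C"
      using convex_rel_interior_if2[OF \<open>convex C\<close>] by blast
    then have "(0, (1 - e) * (p + 1) + e * p) \<in> C" by simp
    from p_min[OF this] e(1) show False by (simp add: algebra_simps)
  qed
  from supporting_hyperplane_rel_boundary[OF \<open>convex C\<close> pC this]
  obtain k where k: "\<And>y. y \<in> C \<Longrightarrow> k \<bullet> (0, p) \<le> k \<bullet> y"
    "\<And>y. y \<in> rel_interior C \<Longrightarrow> k \<bullet> (0, p) < k \<bullet> y"
    by metis
  obtain a \<beta> where kab: "k = (a, \<beta>)" by fastforce
  have sep: "\<beta> * p \<le> a \<bullet> w + \<beta> * r" if "(w, r) \<in> C" for w r using k(1)[OF that] kab by simp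
  \<comment> \<open>Otherwise the separation would fail at \<open>(0, p + 1)\<close>, which belongs
    to \<open>C\<close>.\<close>
  have "\<beta> \<ge> 0" using sep[OF C_up[OF pC, of 1]] by (simp add: distrib_left)
  moreover have "\<beta> \<noteq> 0"
  proof
    assume "\<beta> = 0"
    obtain w r where wr: "(w, r) \<in> rel_interior C"
      using pC \<open>convex C\<close> rel_interior_eq_empty by fastforce
    then have pos: "a \<bullet> w > 0" using k(2)[OF wr] kab \<open>\<beta> = 0\<close> by simp
    have "(w, r) \<in> C" using wr rel_interior_subset by blast
    then obtain u q where u: "w = residual u" "\<forall>i. (u $ i, q i) \<in> ?E i" unfolding C_def by blast
    have "u $ i \<in> effective_domain (X i) (h i)" for i
      using u(2)[rule_format, of i] by (auto simp: ereal_epigraph_def effective_domain_def)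
    from slater_line[OF ub(2) this] obtain e where
      e: "e > 1" "\<And>i. ((1 - e) *\<^sub>R u + e *\<^sub>R ub) $ i \<in> effective_domain (X i) (h i)" by metis
    \<comment> \<open>The residual vanishes at \<open>ub\<close>, so beyond \<open>ub\<close> it is
      a negative multiple of \<open>w\<close>. With \<open>\<beta> = 0\<close> the separation then
      contradicts \<open>a \<bullet> w > 0\<close>.\<close>
    let ?v = "(1 - e) *\<^sub>R u + e *\<^sub>R ub"
    have "residual ?v = (1 - e) *\<^sub>R w"
      using residual_convex_combination[of u ub "1 - e" e] E_block[OF u(2)] ub(1) u(1)
      by (simp add: feasible_iff)
    moreover have "(residual ?v, \<Sum>i\<in>UNIV. ?r ?v i) \<in> C"
      unfolding C_def using in_E[of ?v] dom_finite[OF e(2)] by blast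
    ultimately have "0 \<le> (1 - e) * (a \<bullet> w)" using sep \<open>\<beta> = 0\<close> by fastforce
    then show False using pos e(1) by (simp add: zero_le_mult_iff)
  qed
  ultimately have \<beta>: "\<beta> > 0" by simp
  \<comment> \<open>The slope \<open>a /\<^sub>R \<beta>\<close> need not lie in \<open>X n\<close>.
    The adjoint of the inclusion of \<open>X n\<close> projects it orthogonally there, which
    preserves its inner products with residuals.\<close>
  have "linear_between (X n) UNIV (\<lambda>v. v)" by (simp add: linear_between_def)
  from adjoint_on_works[OF X this, of "a /\<^sub>R \<beta>"]
  obtain l where l: "l \<in> X n" "\<And>v. v \<in> X n \<Longrightarrow> v \<bullet> (a /\<^sub>R \<beta>) = v \<bullet> l" by metis
  show ?thesis
  proof (intro exI conjI ballI impI)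
    fix u assume u: "u \<in> block_space X UNIV" "\<forall>i. h i (u $ i) = ereal (?r u i)"
    have "(residual u, \<Sum>i\<in>UNIV. ?r u i) \<in> C"
      unfolding C_def using in_E[OF u(1)] u(2) by blast
    from sep[OF this] have "p \<le> (\<Sum>i\<in>UNIV. ?r u i) + residual u \<bullet> (a /\<^sub>R \<beta>)"
      using \<beta> by (simp add: field_simps inner_commute)
    then show "p \<le> (\<Sum>i\<in>UNIV. ?r u i) + residual u \<bullet> l" using l(2)[OF residual_in[OF u(1)]] by simp
  qed (use p l in auto)
qed

section \<open>The augmented Lagrangian compared with problem (P)\<close>

lemma sum_UNIV: "(\<Sum>i\<in>UNIV. f i) = (\<Sum>i\<in>I1. f i) + (\<Sum>i\<in>-I1 - {n}. f i) + f n"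
  for f :: "'m \<Rightarrow> 'b::comm_monoid_add"
  using sum_not_n[of f] sum.remove[of UNIV n f] by (simp add: Compl_eq_Diff_UNIV add.commute)

text \<open>Expanding the penalties and dropping their nonnegative quadratic parts leaves terms
  linear in \<open>z\<close> and squares of \<open>z\<close> that cancel the concave term. For this
  \<open>z\<close> the linear terms combine to \<open>residual u \<bullet> l\<close>, so the
  ordinary Lagrangian of (P) at \<open>u\<close> is a lower bound.\<close>

lemma augmented_lagrangian_ge:
  assumes l: "l \<in> X n" and x: "x \<in> block_space X (-{n})" and y: "y \<in> block_space X (-I1 - {n})"
    and xn: "xn \<in> X n"
    and low: "\<And>u. u \<in> block_space X UNIV \<Longrightarrow> \<forall>i. h i (u $ i) = ereal (real_of_ereal (h i (u $ i))) \<Longrightarrow>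
      p \<le> (\<Sum>i\<in>UNIV. real_of_ereal (h i (u $ i))) + residual u \<bullet> l"
  defines "z \<equiv> \<chi> i. if i \<in> I1 then 0 else if i = n then l else adjoint_on (X i) (A i) l"
  shows "ereal p \<le> augmented_lagrangian h A b \<sigma> I1 n x xn y z"
proof -
  let ?J = "-I1 - {n}" and ?hr = "\<lambda>i v. real_of_ereal (h i v)"
  \<comment> \<open>The point made of exactly those arguments at which the augmented Lagrangian
    evaluates the functions \<open>h i\<close>.\<close>
  define u where "u = (\<chi> i. if i \<in> I1 then x $ i else if i = n then xn else y $ i)"
  have Xx: "x $ i \<in> X i" if "i \<noteq> n" for i using x that by (auto simp: block_space_def)
  have Xy: "y $ i \<in> X i" if "i \<in> ?J" for i using y that by (auto simp: block_space_def)
  have u: "u \<in> block_space X UNIV"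
    using Xx Xy xn n by (auto simp: u_def block_space_def)
  have un: "u $ n = xn" using n by (simp add: u_def)
  have uh: "(\<Sum>i\<in>I1. h i (x $ i)) = (\<Sum>i\<in>I1. h i (u $ i))"
    "(\<Sum>i\<in>?J. h i (y $ i)) = (\<Sum>i\<in>?J. h i (u $ i))"
    by (auto simp: u_def intro: sum.cong)
  have obj: "(\<Sum>i\<in>I1. h i (x $ i)) + (\<Sum>i\<in>?J. h i (y $ i)) + h n xn = P_objective h u"
    unfolding P_objective_def sum_UNIV[of "\<lambda>i. h i (u $ i)"] uh un ..
  show ?thesis
  proof (cases "P_objective h u = \<infinity>")
    case True
    then show ?thesis unfolding augmented_lagrangian_def obj by simp
  next
    case False
    then have uf: "\<forall>i. h i (u $ i) = ereal (?hr i (u $ i))" using P_objective_finite_iff[OF u] by blast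
    define r where "r = (\<Sum>i\<in>-{n}. A i (x $ i)) + xn - b"
    have sq: "\<sigma> / 2 * (norm (v + w /\<^sub>R \<sigma>))\<^sup>2 \<ge> v \<bullet> w + 1 / (2 * \<sigma>) * (norm w)\<^sup>2" for v w :: 'a
    proof -
      have "(norm (v + w /\<^sub>R \<sigma>))\<^sup>2 = (norm v)\<^sup>2 + 2 / \<sigma> * (v \<bullet> w) + (norm w)\<^sup>2 / \<sigma>\<^sup>2"
        using power2_norm_diff[of v "- (w /\<^sub>R \<sigma>)"] by (simp add: field_simps)
      then have "\<sigma> / 2 * (norm (v + w /\<^sub>R \<sigma>))\<^sup>2 = \<sigma> / 2 * (norm v)\<^sup>2 + v \<bullet> w + 1 / (2 * \<sigma>) * (norm w)\<^sup>2"
        using \<sigma> by (simp add: field_simps power2_eq_square)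
      then show ?thesis using \<sigma> by simp
    qed
    have 1: "\<sigma> / 2 * (norm (r + z $ n /\<^sub>R \<sigma>))\<^sup>2 \<ge> r \<bullet> l + 1 / (2 * \<sigma>) * (norm (z $ n))\<^sup>2"
      using sq[of r "z $ n"] n by (simp add: z_def)
    have "\<sigma> / 2 * (norm (x $ i - y $ i - z $ i /\<^sub>R \<sigma>))\<^sup>2 \<ge>
        (A i (y $ i) \<bullet> l - A i (x $ i) \<bullet> l) + 1 / (2 * \<sigma>) * (norm (z $ i))\<^sup>2" if i: "i \<in> ?J" for i
    proof -
      \<comment> \<open>The choice of \<open>z $ i\<close> as an adjoint image turns the splitting
        constraint \<open>x $ i = y $ i\<close> into the exchange of \<open>A i (x $ i)\<close> for
        \<open>A i (y $ i)\<close> in the residual.\<close>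
      have "(x $ i - y $ i) \<bullet> z $ i = A i (x $ i) \<bullet> l - A i (y $ i) \<bullet> l"
        using adjoint_A[of i _ l] Xx Xy[OF i] i
        by (subst inner_commute) (simp add: z_def inner_diff_right)
      then show ?thesis using sq[of "x $ i - y $ i" "- z $ i"] by simp
    qed
    then have "(\<Sum>i\<in>?J. \<sigma> / 2 * (norm (x $ i - y $ i - z $ i /\<^sub>R \<sigma>))\<^sup>2) \<ge>
        (\<Sum>i\<in>?J. (A i (y $ i) \<bullet> l - A i (x $ i) \<bullet> l) + 1 / (2 * \<sigma>) * (norm (z $ i))\<^sup>2)"
      by (rule sum_mono)
    then have 2: "\<sigma> / 2 * (\<Sum>i\<in>?J. (norm (x $ i - y $ i - z $ i /\<^sub>R \<sigma>))\<^sup>2) \<ge>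
        (\<Sum>i\<in>?J. A i (y $ i) \<bullet> l) - (\<Sum>i\<in>?J. A i (x $ i) \<bullet> l) + 1 / (2 * \<sigma>) * (\<Sum>i\<in>?J. (norm (z $ i))\<^sup>2)"
      by (simp only: sum.distrib sum_subtractf sum_distrib_left)
    have "residual u = (\<Sum>i\<in>I1. A i (x $ i)) + (\<Sum>i\<in>?J. A i (y $ i)) + xn - b"
      unfolding residual_def un sum_not_n by (simp add: u_def)
    then have res: "residual u \<bullet> l = r \<bullet> l + (\<Sum>i\<in>?J. A i (y $ i) \<bullet> l) - (\<Sum>i\<in>?J. A i (x $ i) \<bullet> l)"
      unfolding r_def sum_not_n by (simp add: inner_diff_left inner_add_left inner_sum_left)
    have 3: "1 / (2 * \<sigma>) * (\<Sum>i\<in>-I1. (norm (z $ i))\<^sup>2) =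
        1 / (2 * \<sigma>) * (norm (z $ n))\<^sup>2 + 1 / (2 * \<sigma>) * (\<Sum>i\<in>?J. (norm (z $ i))\<^sup>2)"
      unfolding sum_I2 by (simp only: distrib_left)
    show ?thesis
      unfolding augmented_lagrangian_def obj P_objective_real[OF uf[rule_format]] r_def[symmetric]
      using low[OF u uf] 1 2 3 res by simp
  qed
qed

text \<open>Feasibility and the choice of \<open>?y\<close> as a copy of \<open>u\<close> annihilate
  both constraint violations. What remains of the penalties are the squares of
  \<open>z $ i /\<^sub>R \<sigma>\<close>, which cancel the concave term for every
  \<open>z\<close>.\<close>

lemma Phi_le_P_objective:
  assumes u: "u \<in> P_feasible X A b n"
  shows "Phi X h A b \<sigma> I1 n (\<chi> i. if i = n then 0 else u $ i, z) \<le> P_objective h u"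
proof -
  let ?J = "-I1 - {n}" and ?x = "\<chi> i. if i = n then 0 else u $ i"
  let ?y = "\<chi> i. if i \<in> ?J then u $ i else 0"
  have ub: "u \<in> block_space X UNIV" and res: "residual u = 0" using u by (auto simp: feasible_iff)
  have "(?y, u $ n) \<in> block_space X ?J \<times> X n" using ub by (auto simp: block_space_def)
  then have "Phi X h A b \<sigma> I1 n (?x, z) \<le> augmented_lagrangian h A b \<sigma> I1 n ?x (u $ n) ?y z"
    unfolding Phi_def prod.case by (rule INF_lower2) simp
  also have "\<dots> = P_objective h u"
  proof -
    have obj: "(\<Sum>i\<in>I1. h i (?x $ i)) + (\<Sum>i\<in>?J. h i (?y $ i)) + h n (u $ n) = P_objective h u"
    proof -
      have "(\<Sum>i\<in>I1. h i (?x $ i)) = (\<Sum>i\<in>I1. h i (u $ i))" using n by (intro sum.cong) auto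
      then show ?thesis unfolding P_objective_def sum_UNIV[of "\<lambda>i. h i (u $ i)"] by simp
    qed
    have r: "(\<Sum>i\<in>-{n}. A i (?x $ i)) + u $ n - b = 0" using res by (simp add: residual_def)
    have sq: "\<sigma> / 2 * (norm (w /\<^sub>R \<sigma>))\<^sup>2 = 1 / (2 * \<sigma>) * (norm w)\<^sup>2" for w :: 'a
      using \<sigma> by (simp add: power_mult_distrib power2_eq_square field_simps)
    have "\<sigma> / 2 * (\<Sum>i\<in>?J. (norm (?x $ i - ?y $ i - z $ i /\<^sub>R \<sigma>))\<^sup>2) = (\<Sum>i\<in>?J. \<sigma> / 2 * (norm (z $ i /\<^sub>R \<sigma>))\<^sup>2)"
      unfolding sum_distrib_left by (intro sum.cong) auto
    then have "1 / (2 * \<sigma>) * (\<Sum>i\<in>-I1. (norm (z $ i))\<^sup>2) =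
        \<sigma> / 2 * (norm ((\<Sum>i\<in>-{n}. A i (?x $ i)) + u $ n - b + z $ n /\<^sub>R \<sigma>))\<^sup>2 +
        \<sigma> / 2 * (\<Sum>i\<in>?J. (norm (?x $ i - ?y $ i - z $ i /\<^sub>R \<sigma>))\<^sup>2)"
      unfolding sq r sum_I2 by (simp only: distrib_left sum_distrib_left sq add_0)
    then show ?thesis
      unfolding augmented_lagrangian_def obj by (cases "P_objective h u") simp_all
  qed
  finally show ?thesis .
qed

text \<open>The inequalities \<open>D \<le> M\<close>, \<open>M \<le> ?V\<close> and
  \<open>?V \<le> D\<close> close a cycle. The first is weak duality, the second compares with
  feasible points, and the third rests on the multiplier.\<close>

lemma strong_duality:
  assumes opt: "xo \<in> P_feasible X A b n" "\<And>u. u \<in> P_feasible X A b n \<Longrightarrow> P_objective h xo \<le> P_objective h u"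
    and ub: "ub \<in> P_feasible X A b n" "\<And>i. ub $ i \<in> rel_interior (effective_domain (X i) (h i))"
  defines "D \<equiv> (SUP z\<in>block_space X (-I1). INF x\<in>block_space X (-{n}). Phi X h A b \<sigma> I1 n (x, z))"
    and "M \<equiv> (INF x\<in>block_space X (-{n}). SUP z\<in>block_space X (-I1). Phi X h A b \<sigma> I1 n (x, z))"
  shows "M = D" "M = (INF x\<in>P_feasible X A b n. P_objective h x)"
proof -
  let ?V = "INF x\<in>P_feasible X A b n. P_objective h x"
  have "D \<le> M" unfolding D_def M_def
    by (intro SUP_least INF_greatest) (rule order_trans[OF INF_lower SUP_upper])
  moreover have "M \<le> ?V"
  proof (rule INF_greatest)
    fix u assume u: "u \<in> P_feasible X A b n"
    let ?x = "\<chi> i. if i = n then 0 else u $ i"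
    have "?x \<in> block_space X (-{n})" using u by (auto simp: P_feasible_def block_space_def)
    then have "M \<le> (SUP z\<in>block_space X (-I1). Phi X h A b \<sigma> I1 n (?x, z))"
      unfolding M_def by (rule INF_lower)
    also have "\<dots> \<le> P_objective h u" by (intro SUP_least Phi_le_P_objective u)
    finally show "M \<le> P_objective h u" .
  qed
  moreover have "?V \<le> D"
  proof -
    obtain p l where p: "P_objective h xo = ereal p" and l: "l \<in> X n"
      and low: "\<And>u. u \<in> block_space X UNIV \<Longrightarrow> \<forall>i. h i (u $ i) = ereal (real_of_ereal (h i (u $ i))) \<Longrightarrow>
        p \<le> (\<Sum>i\<in>UNIV. real_of_ereal (h i (u $ i))) + residual u \<bullet> l"
      using lagrange_multiplier_exists[OF opt ub] by blast
    let ?z = "\<chi> i. if i \<in> I1 then 0 else if i = n then l else adjoint_on (X i) (A i) l"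
    have "?V \<le> ereal p" using INF_lower[OF opt(1), of "P_objective h"] p by simp
    also have "\<dots> \<le> (INF x\<in>block_space X (-{n}). Phi X h A b \<sigma> I1 n (x, ?z))"
    proof (rule INF_greatest)
      fix x assume x: "x \<in> block_space X (-{n})"
      show "ereal p \<le> Phi X h A b \<sigma> I1 n (x, ?z)"
        unfolding Phi_def prod.case
        by (rule INF_greatest) (auto intro!: augmented_lagrangian_ge[OF l x _ _ low])
    qed
    also have "\<dots> \<le> D" unfolding D_def
    proof (rule SUP_upper)
      show "?z \<in> block_space X (-I1)" using l adjoint_A_in by (auto simp: block_space_def)
    qed
    finally show ?thesis .
  qed
  ultimately show "M = D" "M = ?V" by order+
qed

end

theorem lemma2p1:
  fixes X :: "'m::finite \<Rightarrow> 'a::euclidean_space set"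
    and h :: "'m \<Rightarrow> 'a \<Rightarrow> ereal"
    and A :: "'m \<Rightarrow> 'a \<Rightarrow> 'a"
    and b :: 'a and \<sigma> :: real and I1 :: "'m set" and n :: 'm
  assumes "n \<notin> I1"
    and "\<And>i. subspace (X i)"
    and "\<And>i. i \<noteq> n \<Longrightarrow> linear_between (X i) (X n) (A i)"
    and "b \<in> X n"
    and "\<And>i x. i \<in> I1 \<Longrightarrow> x \<in> X i \<Longrightarrow> \<bar>h i x\<bar> \<noteq> \<infinity>"
    and "\<And>i. i \<in> I1 \<Longrightarrow> convex_on (X i) (\<lambda>x. real_of_ereal (h i x))"
    and "\<And>i. i \<in> I1 \<Longrightarrow> twice_continuously_differentiable_on (X i) (h i)"
    and "\<And>i. i \<in> I1 \<Longrightarrow> \<exists>L. L-lipschitz_on (X i) (gradient_on (X i) (h i))"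
    and "\<And>i. i \<notin> I1 \<Longrightarrow> proper_closed_convex (X i) (h i)"
    and "\<sigma> > 0"
  shows
    "(\<forall>x \<in> block_space X (-{n}). \<forall>z \<in> block_space X (-I1).
        let p = (\<lambda>i. prox (X i) \<sigma> (fenchel_conjugate (X i) (h i)) (\<sigma> *\<^sub>R x $ i - z $ i));
            pn = prox (X n) \<sigma> (fenchel_conjugate (X n) (h n))
                   (\<sigma> *\<^sub>R b - z $ n - \<sigma> *\<^sub>R (\<Sum>j\<in>-{n}. A j (x $ j)))
        in \<exists>gx gz.
            has_gradient_on (block_space X (-{n}) \<times> block_space X (-I1))
              (Phi X h A b \<sigma> I1 n) (gx, gz) (x, z) \<and>
            (\<forall>i \<in> I1. gx $ i = gradient_on (X i) (h i) (x $ i) - adjoint_on (X i) (A i) pn) \<and>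
            (\<forall>i \<in> -I1 - {n}. gx $ i = p i - adjoint_on (X i) (A i) pn) \<and>
            (\<forall>i \<in> -I1 - {n}. gz $ i = - (1 / \<sigma>) *\<^sub>R z $ i - (1 / \<sigma>) *\<^sub>R p i) \<and>
            gz $ n = - (1 / \<sigma>) *\<^sub>R z $ n - (1 / \<sigma>) *\<^sub>R pn) \<and>
     ((\<exists>x \<in> P_feasible X A b n. \<forall>u \<in> P_feasible X A b n. P_objective h x \<le> P_objective h u) \<and>
      (\<exists>x \<in> P_feasible X A b n. \<forall>i. x $ i \<in> rel_interior (effective_domain (X i) (h i)))
      \<longrightarrow>
      (INF x \<in> block_space X (-{n}). SUP z \<in> block_space X (-I1). Phi X h A b \<sigma> I1 n (x, z)) =
      (SUP z \<in> block_space X (-I1). INF x \<in> block_space X (-{n}). Phi X h A b \<sigma> I1 n (x, z)) \<and>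
      (INF x \<in> block_space X (-{n}). SUP z \<in> block_space X (-I1). Phi X h A b \<sigma> I1 n (x, z)) =
      (INF x \<in> P_feasible X A b n. P_objective h x))"
proof -
  have gradient: "has_gradient_on (X i) (h i) (gradient_on (X i) (h i) x) x" if "i \<in> I1" "x \<in> X i" for i x
    using assms(7)[OF that(1)] that(2) by (simp add: twice_continuously_differentiable_on_def)
  interpret block_problem X h A b \<sigma> I1 n
    by unfold_locales (fact assms gradient)+
  show ?thesis
  proof (intro conjI ballI impI)
    fix x z assume "x \<in> block_space X (-{n})" "z \<in> block_space X (-I1)"
    from Phi_has_gradient[OF this] n
    show "let p = (\<lambda>i. prox (X i) \<sigma> (fenchel_conjugate (X i) (h i)) (\<sigma> *\<^sub>R x $ i - z $ i));
            pn = prox (X n) \<sigma> (fenchel_conjugate (X n) (h n))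
                   (\<sigma> *\<^sub>R b - z $ n - \<sigma> *\<^sub>R (\<Sum>j\<in>-{n}. A j (x $ j)))
        in \<exists>gx gz.
            has_gradient_on (block_space X (-{n}) \<times> block_space X (-I1))
              (Phi X h A b \<sigma> I1 n) (gx, gz) (x, z) \<and>
            (\<forall>i \<in> I1. gx $ i = gradient_on (X i) (h i) (x $ i) - adjoint_on (X i) (A i) pn) \<and>
            (\<forall>i \<in> -I1 - {n}. gx $ i = p i - adjoint_on (X i) (A i) pn) \<and>
            (\<forall>i \<in> -I1 - {n}. gz $ i = - (1 / \<sigma>) *\<^sub>R z $ i - (1 / \<sigma>) *\<^sub>R p i) \<and>
            gz $ n = - (1 / \<sigma>) *\<^sub>R z $ n - (1 / \<sigma>) *\<^sub>R pn"
      unfolding Let_def by (intro exI conjI) (assumption, auto)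
  qed (use strong_duality in blast)+
qed

end
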